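(* Let $2\le k\le n$ be integers and $$\Gamma_k=\{\lambda\in\mathbb{R}^n:\sigma_j(\lambda)>0\ \text{for all } j=1,\dots,k\}.$$ Let $$\mathcal{A}_k=\Big\{A\in S^n_+(\mathbb{R}):\ \lambda_i^2(A)=\sigma_{k-1,i}(\gamma)\ (i=1,\dots,n)\ \text{with }\gamma=(\gamma_1,\dots,\gamma_n)\in\Gamma_k\text{ and }\sigma_k(\gamma)=1\Big\}.$$ Then, for every $M\in S^n(\mathbb{R})$, $$\inf_{A\in\mathcal{A}_k}\operatorname{trace}(A^tMA)=\begin{cases}k\,\sigma_k(\lambda(M))^{1/k}&\text{if }\lambda(M)\in\overline{\Gamma}_k,\\ -\infty&\text{otherwise.}\end{cases}$$
   Context: $S^n(\mathbb{R})$ is the set of real symmetric $n\times n$ matrices, $S^n_+(\mathbb{R})$ the subset of positive semi-definite ones. $\lambda(M)=(\lambda_1(M),\dots,\lambda_n(M))$ is the vector of eigenvalues of $M$ counted with multiplicity (the order is immaterial here, since $\Gamma_k$ and $\sigma_k$ are invariant under permutations). $\sigma_j(\lambda_1,\dots,\lambda_n)=\sum_{1\le i_1<\cdots<i_j\le n}\lambda_{i_1}\cdots\lambda_{i_j}$ is the $j$-th elementary symmetric polynomial, and $$\sigma_{k-1,i}(\gamma_1,\dots,\gamma_n)=\sigma_{k-1}(\gamma_1,\dots,\gamma_{i-1},0,\gamma_{i+1},\dots,\gamma_n).$$ $\overline{\Gamma}_k$ is the closure of $\Gamma_k$, which equals $\{\lambda\in\mathbb{R}^n:\sigma_j(\lambda)\ge0,\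 j=1,\dots,k\}$. *)

theory Defs
  imports "HOL-Analysis.Analysis"
begin

definition elem_sym :: "nat \<Rightarrow> real ^ 'n \<Rightarrow> real" where
  "elem_sym j l = (\<Sum>I | I \<subseteq> (UNIV :: 'n set) \<and> card I = j. \<Prod>i\<in>I. l $ i)"

definition elem_sym_omit :: "nat \<Rightarrow> 'n \<Rightarrow> real ^ 'n \<Rightarrow> real" where
  "elem_sym_omit j i g = elem_sym j (\<chi> m. if m = i then 0 else g $ m)"

definition Gamma_cone :: "nat \<Rightarrow> (real ^ 'n) set" where
  "Gamma_cone k = {l. \<forall>j\<in>{1..k}. elem_sym j l > 0}"

definition sym_matrices :: "(real ^ 'n ^ 'n) set" where
  "sym_matrices = {M. transpose M = M}"

definition psd_matrices :: "(real ^ 'n ^ 'n) set" where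
  "psd_matrices = {A \<in> sym_matrices. \<forall>x. 0 \<le> x \<bullet> (A *v x)}"

text \<open>The eigenvalues with multiplicity are the roots of the characteristic polynomial
  \<open>det (x I - M)\<close>, listed in an arbitrary order. The vector is only meaningful if this
  polynomial splits over the reals, as it does for every symmetric \<open>M\<close>.\<close>

definition eigvals :: "real ^ 'n ^ 'n \<Rightarrow> real ^ 'n" where
  "eigvals M = (SOME l. \<forall>x. det (mat x - M) = (\<Prod>i\<in>UNIV. x - l $ i))"

definition A_set :: "nat \<Rightarrow> (real ^ 'n ^ 'n) set" where
  "A_set k = {A \<in> psd_matrices. \<exists>g \<in> Gamma_cone k. elem_sym k g = 1 \<and>
     (\<forall>i. (eigvals A $ i)\<^sup>2 = elem_sym_omit (k - 1) i g)}"

end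

theory Submission
  imports Defs "HOL-Computational_Algebra.Polynomial"
begin

text \<open>
  Write \<open>\<sigma>\<^sub>k\<close> for the elementary symmetric polynomial and \<open>d\<^sub>i = \<sigma>\<^sub>k\<^sub>-\<^sub>1\<^sub>,\<^sub>i(\<gamma>)\<close>. Diagonalising \<open>M\<close> and \<open>A\<close> turns
  the trace into \<open>\<Sum> P\<^sub>i\<^sub>j d\<^sub>i \<lambda>\<^sub>j\<close> with \<open>P\<close> doubly stochastic, which is at least \<open>\<Sum> d\<^sub>i \<lambda>\<^sub>i\<close> for a
  suitable ordering of the eigenvalues \<open>\<lambda>\<close>; every such diagonal value is attained by some \<open>A\<close>.
  The sum \<open>\<Sum> d\<^sub>i \<lambda>\<^sub>i\<close> is the derivative of \<open>\<sigma>\<^sub>k\<close> at \<open>\<gamma>\<close> in direction \<open>\<lambda>\<close>, so Garding's inequality bounds it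
  below by \<open>k \<sigma>\<^sub>k(\<lambda>)^(1/k)\<close> on the closed cone. Garding's inequality follows from the Marcus--Lopes
  superadditivity of the quotients \<open>\<sigma>\<^sub>j\<^sub>+\<^sub>1 / \<sigma>\<^sub>j\<close>, whose product is \<open>\<sigma>\<^sub>k\<close>, and from the arithmetic-geometric
  mean inequality. The bound is approached by the normalisations of \<open>\<lambda> + c\<close> as \<open>c\<close> decreases to 0.

  If \<open>\<lambda>\<close> lies outside the closed cone, let \<open>\<mu> = \<lambda> + s\<close> be the first point of the cone on the diagonal
  ray. If the infimum were finite, evaluating at \<open>\<mu> + c\<close> would give \<open>\<sigma>\<^sub>k(\<mu> + c) = O(c^k)\<close>, which forces
  \<open>\<sigma>\<^sub>1(\<mu>) = 0\<close> and hence \<open>\<mu> = 0\<close>; for constant negative \<open>\<lambda>\<close> the functional is unbounded because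
  \<open>\<sigma>\<^sub>k\<^sub>-\<^sub>1\<close> is unbounded on the level set \<open>\<sigma>\<^sub>k = 1\<close>.
\<close>

section \<open>Elementary symmetric polynomials over finite sets\<close>

text \<open>Index sets are arbitrary finite sets so that an index can be deleted:
  \<open>esym (S - {i}) j\<close> is the \<open>i\<close>-th partial derivative of
  \<open>esym S (Suc j)\<close>, and several inductions pass to \<open>S - {i}\<close>.\<close>

definition esym :: "'a set \<Rightarrow> nat \<Rightarrow> ('a \<Rightarrow> real) \<Rightarrow> real" where
  "esym S j x = (\<Sum>I | I \<subseteq> S \<and> card I = j. \<Prod>i\<in>I. x i)"

lemma finite_subsets_card: "finite S \<Longrightarrow> finite {I. I \<subseteq> S \<and> card I = j}"
  by (rule finite_subset[of _ "Pow S"]) auto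

lemma esym_0 [simp]: "finite S \<Longrightarrow> esym S 0 x = 1"
proof -
  assume "finite S"
  hence "{I. I \<subseteq> S \<and> card I = 0} = {{}}"
    by (auto dest: finite_subset)
  thus ?thesis by (simp add: esym_def)
qed

lemma esym_insert:
  assumes "finite S" "a \<notin> S"
  shows "esym (insert a S) (Suc j) x = esym S (Suc j) x + x a * esym S j x"
proof -
  have eq: "{I. I \<subseteq> insert a S \<and> card I = Suc j} =
      {I. I \<subseteq> S \<and> card I = Suc j} \<union> insert a ` {I. I \<subseteq> S \<and> card I = j}" (is "?L = ?A \<union> ?B")
  proof (intro equalityI subsetI)
    fix I assume "I \<in> ?L"
    hence I: "I \<subseteq> insert a S" "card I = Suc j" by auto
    show "I \<in> ?A \<union> ?B"
    proof (cases "a \<in> I")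
      case True
      have "I = insert a (I - {a})" "I - {a} \<subseteq> S" "card (I - {a}) = j"
        using I True by auto
      thus ?thesis by blast
    qed (use I in auto)
  next
    fix I assume "I \<in> ?A \<union> ?B"
    thus "I \<in> ?L"
    proof
      assume "I \<in> ?B"
      then obtain J where J: "I = insert a J" "J \<subseteq> S" "card J = j" by auto
      moreover have "finite J" "a \<notin> J" using J assms finite_subset by blast+
      ultimately show ?thesis by auto
    qed auto
  qed
  have inj: "inj_on (insert a) {I. I \<subseteq> S \<and> card I = j}"
    using assms by (intro inj_onI) (auto simp: insert_ident subset_iff)
  have "esym (insert a S) (Suc j) x = esym S (Suc j) x +
      (\<Sum>I\<in>insert a ` {I. I \<subseteq> S \<and> card I = j}. \<Prod>i\<in>I. x i)"
    unfolding esym_def eq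
    by (rule sum.union_disjoint) (use assms in \<open>auto intro: finite_subsets_card\<close>)
  also have "(\<Sum>I\<in>insert a ` {I. I \<subseteq> S \<and> card I = j}. \<Prod>i\<in>I. x i)
      = (\<Sum>I | I \<subseteq> S \<and> card I = j. x a * (\<Prod>i\<in>I. x i))"
    by (subst sum.reindex[OF inj])
       (use assms in \<open>auto intro!: sum.cong prod.insert intro: finite_subset[OF _ assms(1)]\<close>)
  finally show ?thesis by (simp add: esym_def sum_distrib_left)
qed

lemma esym_remove:
  "finite S \<Longrightarrow> i \<in> S \<Longrightarrow> esym S (Suc j) x = esym (S - {i}) (Suc j) x + x i * esym (S - {i}) j x"
  using esym_insert[of "S - {i}" i j x] by (simp add: insert_absorb)

lemma esym_scale: "esym S j (\<lambda>i. c * x i) = c ^ j * esym S j x"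
  unfolding esym_def sum_distrib_left by (intro sum.cong) (auto simp: prod.distrib)

lemma esym_eq_0: "finite S \<Longrightarrow> card S < j \<Longrightarrow> esym S j x = 0"
  by (auto simp: esym_def intro!: sum.neutral dest: card_mono)

lemma esym_one: "finite S \<Longrightarrow> esym S j (\<lambda>_. 1) = real (card S choose j)"
  by (simp add: esym_def n_subsets)

text \<open>Double counting: a set \<open>I\<close> with a marked element \<open>i\<close>
  corresponds to the pair of \<open>i\<close> and \<open>I - {i}\<close>. Both Euler's identity and
  the derivative of \<open>esym\<close> are instances.\<close>

lemma sum_subsets_pick:
  assumes "finite S"
  shows "(\<Sum>I | I \<subseteq> S \<and> card I = Suc j. \<Sum>i\<in>I. f i (I - {i})) =
    (\<Sum>i\<in>S. \<Sum>J | J \<subseteq> S - {i} \<and> card J = j. f i J)"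
proof -
  have fin: "\<And>I. I \<subseteq> S \<Longrightarrow> finite I"
    using assms finite_subset by blast
  have "(\<Sum>I | I \<subseteq> S \<and> card I = Suc j. \<Sum>i\<in>I. f i (I - {i})) =
     (\<Sum>(I, i)\<in>Sigma {I. I \<subseteq> S \<and> card I = Suc j} (\<lambda>I. I). f i (I - {i}))"
    by (rule sum.Sigma) (use assms in \<open>auto intro: finite_subsets_card fin\<close>)
  also have "\<dots> = (\<Sum>(i, J)\<in>Sigma S (\<lambda>i. {J. J \<subseteq> S - {i} \<and> card J = j}). f i J)"
    by (rule sum.reindex_bij_witness[where i = "\<lambda>(i, J). (insert i J, i)"
          and j = "\<lambda>(I, i). (i, I - {i})"])
       (use fin in \<open>auto simp: card_insert_if finite_subset[OF _ assms] subset_Diff_insert\<close>)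
  also have "\<dots> = (\<Sum>i\<in>S. \<Sum>J | J \<subseteq> S - {i} \<and> card J = j. f i J)"
    by (rule sum.Sigma[symmetric]) (use assms in \<open>auto intro: finite_subsets_card\<close>)
  finally show ?thesis .
qed

text \<open>Euler's identity for a homogeneous polynomial of degree \<open>Suc j\<close>.\<close>

lemma sum_mult_esym_remove:
  assumes "finite S"
  shows "(\<Sum>i\<in>S. x i * esym (S - {i}) j x) = real (Suc j) * esym S (Suc j) x"
proof -
  have "(\<Sum>i\<in>S. x i * esym (S - {i}) j x) =
      (\<Sum>I | I \<subseteq> S \<and> card I = Suc j. \<Sum>i\<in>I. x i * (\<Prod>m\<in>I - {i}. x m))"
    using sum_subsets_pick[OF assms, where f = "\<lambda>i J. x i * (\<Prod>m\<in>J. x m)" and j = j]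
    by (simp add: esym_def sum_distrib_left)
  also have "\<dots> = (\<Sum>I | I \<subseteq> S \<and> card I = Suc j. real (Suc j) * (\<Prod>m\<in>I. x m))"
  proof (intro sum.cong refl)
    fix I assume I: "I \<in> {I. I \<subseteq> S \<and> card I = Suc j}"
    hence fin: "finite I" using assms finite_subset by blast
    have "(\<Sum>i\<in>I. x i * (\<Prod>m\<in>I - {i}. x m)) = (\<Sum>i\<in>I. \<Prod>m\<in>I. x m)"
      by (intro sum.cong refl) (simp add: prod.remove[OF fin])
    thus "(\<Sum>i\<in>I. x i * (\<Prod>m\<in>I - {i}. x m)) = real (Suc j) * (\<Prod>m\<in>I. x m)"
      using I by simp
  qed
  finally show ?thesis by (simp add: esym_def sum_distrib_left)
qed

text \<open>A subset \<open>J\<close> of size \<open>j\<close> survives the deletion of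
  \<open>i\<close> for precisely the \<open>card S - j\<close> indices outside it. The right side is
  the derivative of \<open>esym S (Suc j)\<close> along the diagonal.\<close>

lemma sum_esym_remove:
  assumes "finite S"
  shows "(\<Sum>i\<in>S. esym (S - {i}) j x) = real (card S - j) * esym S j x"
proof -
  have "(\<Sum>i\<in>S. esym (S - {i}) j x) =
     (\<Sum>i\<in>S. \<Sum>J | J \<subseteq> S \<and> card J = j. if i \<in> J then 0 else \<Prod>m\<in>J. x m)"
    unfolding esym_def
    by (intro sum.cong refl sum.mono_neutral_cong_left finite_subsets_card[OF assms]) auto
  also have "\<dots> = (\<Sum>J | J \<subseteq> S \<and> card J = j. \<Sum>i\<in>S. if i \<in> J then 0 else \<Prod>m\<in>J. x m)"
    by (rule sum.swap)
  also have "\<dots> = (\<Sum>J | J \<subseteq> S \<and> card J = j. real (card S - j) * (\<Prod>m\<in>J. x m))"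
  proof (intro sum.cong refl)
    fix J assume J: "J \<in> {J. J \<subseteq> S \<and> card J = j}"
    hence fin: "finite J" using assms finite_subset by blast
    have "(\<Sum>i\<in>S. if i \<in> J then 0 else \<Prod>m\<in>J. x m) = (\<Sum>i\<in>S - J. \<Prod>m\<in>J. x m)"
      by (rule sum.mono_neutral_cong_right) (use assms in auto)
    thus "(\<Sum>i\<in>S. if i \<in> J then 0 else \<Prod>m\<in>J. x m) = real (card S - j) * (\<Prod>m\<in>J. x m)"
      using J fin by (simp add: card_Diff_subset)
  qed
  finally show ?thesis by (simp add: esym_def sum_distrib_left)
qed

text \<open>Taylor expansion along the diagonal: the binomial coefficient counts the extensions of
  an \<open>m\<close>-subset to a \<open>j\<close>-subset of \<open>S\<close>.\<close>

lemma esym_shift: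
  assumes "finite S"
  shows "esym S j (\<lambda>i. x i + c) = (\<Sum>m\<le>j. real ((card S - m) choose (j - m)) * c ^ (j - m) * esym S m x)"
  using assms
proof (induction S arbitrary: j rule: finite_induct)
  case empty
  show ?case
  proof (cases j)
    case (Suc j')
    have "real ((0 - m) choose (Suc j' - m)) * c ^ (Suc j' - m) * esym {} m x = 0" if "m \<le> Suc j'" for m
      by (cases "m = 0") (use that in \<open>auto simp: esym_eq_0\<close>)
    hence "(\<Sum>m\<le>Suc j'. real ((0 - m) choose (Suc j' - m)) * c ^ (Suc j' - m) * esym {} m x) = 0"
      by (intro sum.neutral) blast
    thus ?thesis by (simp add: Suc esym_eq_0 del: sum.atMost_Suc)
  qed simp
next
  case (insert a S)
  show ?case
  proof (cases j)
    case (Suc i)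
    let ?n = "card S"
    have "(\<Sum>m\<le>Suc i. real ((Suc ?n - m) choose (Suc i - m)) * c ^ (Suc i - m) * esym (insert a S) m x) =
       real (Suc ?n choose Suc i) * c ^ Suc i + (\<Sum>m\<le>i. real ((?n - m) choose (i - m)) * c ^ (i - m) * esym (insert a S) (Suc m) x)"
      by (subst sum.atMost_Suc_shift) (use insert.hyps in simp)
    also have "\<dots> = real (Suc ?n choose Suc i) * c ^ Suc i
       + (\<Sum>m\<le>i. real ((?n - m) choose (i - m)) * c ^ (i - m) * esym S (Suc m) x)
       + x a * esym S i (\<lambda>i. x i + c)"
      unfolding esym_insert[OF insert.hyps] insert.IH sum_distrib_left
      by (simp add: sum.distrib[symmetric] algebra_simps)
    also have "real (Suc ?n choose Suc i) * c ^ Suc i + (\<Sum>m\<le>i. real ((?n - m) choose (i - m)) * c ^ (i - m) * esym S (Suc m) x)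
       = esym S (Suc i) (\<lambda>i. x i + c) + c * esym S i (\<lambda>i. x i + c)"
    proof -
      \<comment> \<open>Pascal's rule. For \<open>m > ?n\<close> the truncated subtractions do no
        harm, since \<open>esym S m x\<close> vanishes.\<close>
      have "real ((?n - m) choose (Suc i - m)) * c ^ (Suc i - m) * esym S m x + c * (real ((?n - m) choose (i - m)) * c ^ (i - m) * esym S m x)
         = real ((Suc ?n - m) choose (Suc i - m)) * c ^ (Suc i - m) * esym S m x" if "m \<le> i" for m
      proof (cases "m \<le> ?n")
        case True
        hence "Suc ?n - m = Suc (?n - m)" "Suc i - m = Suc (i - m)" using that by auto
        thus ?thesis by (simp add: algebra_simps)
      qed (use insert.hyps in \<open>simp add: esym_eq_0\<close>)
      hence "esym S (Suc i) (\<lambda>i. x i + c) + c * esym S i (\<lambda>i. x i + c) =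
        (\<Sum>m\<le>i. real ((Suc ?n - m) choose (Suc i - m)) * c ^ (Suc i - m) * esym S m x) + esym S (Suc i) x"
        unfolding insert.IH sum_distrib_left by (simp add: sum.distrib[symmetric])
      also have "\<dots> = (\<Sum>m\<le>Suc i. real ((Suc ?n - m) choose (Suc i - m)) * c ^ (Suc i - m) * esym S m x)"
        by simp
      also have "\<dots> = real (Suc ?n choose Suc i) * c ^ Suc i + (\<Sum>m\<le>i. real ((?n - m) choose (i - m)) * c ^ (i - m) * esym S (Suc m) x)"
        by (subst sum.atMost_Suc_shift) (use insert.hyps in simp)
      finally show ?thesis by simp
    qed
    finally show ?thesis
      using insert.hyps by (simp add: Suc esym_insert algebra_simps)
  qed (use insert.hyps in simp)
qed

lemma esym_1: "finite S \<Longrightarrow> esym S (Suc 0) x = sum x S"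
  using sum_mult_esym_remove[of S x 0] by simp

text \<open>Serves to conclude that a vector with vanishing first and nonnegative second elementary
  symmetric value is zero.\<close>

lemma esym_2: "finite S \<Longrightarrow> (sum x S)\<^sup>2 = (\<Sum>i\<in>S. (x i)\<^sup>2) + 2 * esym S 2 x"
proof -
  assume fin: "finite S"
  have "2 * esym S 2 x = (\<Sum>i\<in>S. x i * (sum x S - x i))"
    using sum_mult_esym_remove[OF fin, of x 1] fin
    by (simp add: esym_1 sum_diff1 numeral_2_eq_2)
  thus ?thesis
    by (simp add: right_diff_distrib sum_subtractf power2_eq_square sum_distrib_right)
qed

lemma continuous_on_esym [continuous_intros]:
  "finite S \<Longrightarrow> (\<And>i. i \<in> S \<Longrightarrow> continuous_on T (\<lambda>t. f t i)) \<Longrightarrow> continuous_on T (\<lambda>t. esym S j (f t))"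
  unfolding esym_def by (intro continuous_intros) auto

lemma tendsto_esym [tendsto_intros]:
  "(\<And>i. i \<in> S \<Longrightarrow> ((\<lambda>t. f t i) \<longlongrightarrow> x i) F) \<Longrightarrow> ((\<lambda>t. esym S j (f t)) \<longlongrightarrow> esym S j x) F"
  unfolding esym_def by (intro tendsto_intros) auto

section \<open>Newton's and Garding's inequalities\<close>

text \<open>The cardinality hypothesis says that all roots are real and simple. Splitting off a
  factor, \<open>p = (t - r) q\<close>, turns \<open>p'^2 - p p''\<close> into
  \<open>q^2 + (t - r)^2 (q'^2 - q q'')\<close>, so nonnegativity passes from \<open>q\<close> to
  \<open>p\<close>.\<close>

lemma laguerre_inequality:
  fixes p :: "real poly"
  assumes "finite R" "card R = degree p" "p \<noteq> 0" "\<forall>r\<in>R. poly p r = 0"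
  shows "poly p t * poly (pderiv (pderiv p)) t \<le> (poly (pderiv p) t)\<^sup>2"
  using assms
proof (induction R arbitrary: p rule: finite_induct)
  case empty
  hence "pderiv p = 0" by (simp add: pderiv_eq_0_iff)
  thus ?case by simp
next
  case (insert r R)
  then obtain q where q: "p = [:-r, 1:] * q"
    by (auto simp: poly_eq_0_iff_dvd)
  have q0: "q \<noteq> 0" using insert.prems q by auto
  have "degree p = Suc (degree q)"
    unfolding q using q0 by (subst degree_mult_eq) auto
  hence card: "card R = degree q" using insert by simp
  have roots: "\<forall>s\<in>R. poly q s = 0"
  proof
    fix s assume s: "s \<in> R"
    hence "poly p s = 0" "s \<noteq> r" using insert by auto
    thus "poly q s = 0" by (simp add: q)
  qed
  have d1: "pderiv p = q + [:-r, 1:] * pderiv q"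
    unfolding q pderiv_mult by (simp add: pderiv_pCons)
  have d2: "pderiv (pderiv p) = 2 * pderiv q + [:-r, 1:] * pderiv (pderiv q)"
    unfolding d1 pderiv_add pderiv_mult by (simp add: pderiv_pCons)
  have ev: "poly p t = (t - r) * poly q t"
    "poly (pderiv p) t = poly q t + (t - r) * poly (pderiv q) t"
    "poly (pderiv (pderiv p)) t = 2 * poly (pderiv q) t + (t - r) * poly (pderiv (pderiv q)) t"
    unfolding d2 unfolding d1 unfolding q by (simp_all add: algebra_simps)
  have "(poly (pderiv p) t)\<^sup>2 - poly p t * poly (pderiv (pderiv p)) t =
      (poly q t)\<^sup>2 + (t - r)\<^sup>2 * ((poly (pderiv q) t)\<^sup>2 - poly q t * poly (pderiv (pderiv q)) t)"
    unfolding ev by (simp add: power2_eq_square algebra_simps)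
  also have "\<dots> \<ge> 0"
    using insert.IH[OF card q0 roots] by (intro add_nonneg_nonneg mult_nonneg_nonneg) auto
  finally show ?case by simp
qed

text \<open>Rolle's theorem between each root and its successor \<open>nxt r\<close>. One root is
  lost, matching the drop in degree, so a polynomial with only simple real roots keeps this property
  under differentiation.\<close>

lemma roots_pderiv_exist:
  fixes p :: "real poly"
  assumes fin: "finite R" and roots: "\<forall>r\<in>R. poly p r = 0"
  shows "\<exists>R'. finite R' \<and> card R' = card R - 1 \<and> (\<forall>r\<in>R'. poly (pderiv p) r = 0)"
proof (cases "R = {}")
  case False
  define nxt where "nxt r = Min {s \<in> R. r < s}" for r
  have nxt: "nxt r \<in> R" "r < nxt r" "\<And>s. s \<in> R \<Longrightarrow> r < s \<Longrightarrow> nxt r \<le> s" if "r \<in> R - {Max R}" for r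
  proof -
    have "r < Max R" using that Max_ge[OF fin, of r] by fastforce
    hence ne: "{s \<in> R. r < s} \<noteq> {}" using Max_in[OF fin False] by auto
    have "nxt r \<in> {s \<in> R. r < s}" unfolding nxt_def by (rule Min_in) (use ne fin in auto)
    thus "nxt r \<in> R" "r < nxt r" by auto
    show "\<And>s. s \<in> R \<Longrightarrow> r < s \<Longrightarrow> nxt r \<le> s"
      unfolding nxt_def by (rule Min_le) (use fin in auto)
  qed
  have "\<exists>z. r < z \<and> z < nxt r \<and> poly (pderiv p) z = 0" if "r \<in> R - {Max R}" for r
    using poly_MVT[OF nxt(2)[OF that], of p] roots nxt[OF that] that by auto
  then obtain z where z: "\<And>r. r \<in> R - {Max R} \<Longrightarrow> r < z r \<and> z r < nxt r \<and> poly (pderiv p) (z r) = 0"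
    by metis
  have less: "z r < z r'" if "r \<in> R - {Max R}" "r' \<in> R - {Max R}" "r < r'" for r r'
    using z[OF that(1)] z[OF that(2)] nxt(3)[OF that(1), of r'] that by auto
  have "inj_on z (R - {Max R})"
    by (intro inj_onI) (metis less linorder_neqE less_irrefl)
  hence "card (z ` (R - {Max R})) = card R - 1"
    using fin False by (simp add: card_image)
  thus ?thesis
    using z fin by (intro exI[of _ "z ` (R - {Max R})"]) auto
qed auto

lemma coeff_prod_linear: "finite S \<Longrightarrow> coeff (\<Prod>i\<in>S. [:1, x i:]) j = esym S j x"
proof (induction S arbitrary: j rule: finite_induct)
  case empty
  show ?case by (cases j) (simp_all add: esym_eq_0)
next
  case (insert a S)
  thus ?case by (cases j) (simp_all add: coeff_pCons esym_insert)
qed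

text \<open>The product of the factors \<open>1 + x i * t\<close> has the distinct real roots
  \<open>- inverse (x i)\<close> and the elementary symmetric values as coefficients. Its
  \<open>k\<close>-th derivative is still real-rooted, and Laguerre's inequality for it at 0
  compares three consecutive coefficients.\<close>

lemma newton_inequality_distinct:
  assumes fin: "finite S" and inj: "inj_on x S" and nz: "\<forall>i\<in>S. x i \<noteq> 0"
  shows "esym S k x * esym S (Suc (Suc k)) x \<le> (esym S (Suc k) x)\<^sup>2"
proof (cases "k < card S")
  case False
  thus ?thesis using fin by (simp add: esym_eq_0)
next
  case True
  define p where "p = (\<Prod>i\<in>S. [:1, x i:])"
  have deg: "degree p = card S"
    unfolding p_def using nz by (subst degree_prod_eq_sum_degree) auto
  have "\<exists>R. finite R \<and> card R = card S - m \<and> (\<forall>r\<in>R. poly ((pderiv ^^ m) p) r = 0)" for m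
  proof (induction m)
    case 0
    let ?R = "(\<lambda>i. - inverse (x i)) ` S"
    have "inj_on (\<lambda>i. - inverse (x i)) S"
      using inj by (auto simp: inj_on_def)
    moreover have "poly p (- inverse (x i)) = 0" if "i \<in> S" for i
      unfolding p_def poly_prod using that fin nz by (intro prod_zero bexI[of _ i]) auto
    ultimately show ?case
      using fin by (intro exI[of _ ?R]) (auto simp: card_image)
  next
    case (Suc m)
    then obtain R where R: "finite R" "card R = card S - m" "\<forall>r\<in>R. poly ((pderiv ^^ m) p) r = 0"
      by blast
    thus ?case using roots_pderiv_exist[OF R(1,3)] by auto
  qed
  then obtain R where R: "finite R" "card R = card S - k" "\<forall>r\<in>R. poly ((pderiv ^^ k) p) r = 0"
    by blast
  have degk: "degree ((pderiv ^^ k) p) = card S - k" by (simp add: degree_higher_pderiv deg)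
  hence ne: "(pderiv ^^ k) p \<noteq> 0" using True by auto
  have ev: "poly ((pderiv ^^ m) p) 0 = fact m * esym S m x" for m
    by (simp add: poly_0_coeff_0 coeff_higher_pderiv pochhammer_fact p_def coeff_prod_linear[OF fin])
  have "poly ((pderiv ^^ k) p) 0 * poly ((pderiv ^^ Suc (Suc k)) p) 0 \<le> (poly ((pderiv ^^ Suc k) p) 0)\<^sup>2"
    using laguerre_inequality[OF R(1) _ ne R(3)] R(2) degk by simp
  hence "fact k * fact (Suc (Suc k)) * (esym S k x * esym S (Suc (Suc k)) x) \<le> (fact (Suc k))\<^sup>2 * (esym S (Suc k) x)\<^sup>2"
    unfolding ev by (simp only: power_mult_distrib mult_ac)
  moreover have "(fact (Suc k))\<^sup>2 * B = (fact k * fact (Suc k)) * (real (Suc k) * B)" for B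
    by (simp only: power2_eq_square fact_Suc of_nat_mult mult_ac)
  moreover have "fact k * fact (Suc (Suc k)) * B = (fact k * fact (Suc k)) * (real (Suc (Suc k)) * B)" for B
    by (simp only: fact_Suc[of "Suc k"] of_nat_mult mult_ac)
  ultimately have "(fact k * fact (Suc k)) * (real (Suc (Suc k)) * (esym S k x * esym S (Suc (Suc k)) x))
      \<le> (fact k * fact (Suc k)) * (real (Suc k) * (esym S (Suc k) x)\<^sup>2)"
    by metis
  hence "real (Suc (Suc k)) * (esym S k x * esym S (Suc (Suc k)) x) \<le> real (Suc k) * (esym S (Suc k) x)\<^sup>2"
    by (rule mult_left_le_imp_le) simp
  \<comment> \<open>Weakening the factor \<open>Suc k\<close> on the right to
    \<open>Suc (Suc k)\<close> lets the factors cancel.\<close>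
  hence "real (Suc (Suc k)) * (esym S k x * esym S (Suc (Suc k)) x) \<le> real (Suc (Suc k)) * (esym S (Suc k) x)\<^sup>2"
    by (rule order_trans) (intro mult_right_mono, auto)
  thus ?thesis by (simp only: mult_le_cancel_left_pos of_nat_0_less_iff zero_less_Suc)
qed

text \<open>Perturb the entries by \<open>e\<close> times distinct positive integers, the
  \<open>Suc\<close> guarding against weight 0. Each coincidence or zero excludes a single
  \<open>e\<close>, so the distinct case applies for all small nonzero \<open>e\<close>, and the
  inequality survives the limit.\<close>

lemma newton_inequality:
  assumes fin: "finite S"
  shows "esym S k x * esym S (Suc (Suc k)) x \<le> (esym S (Suc k) x)\<^sup>2"
proof -
  obtain h :: "'a \<Rightarrow> nat" where h: "inj_on h S"
    using fin finite_imp_inj_to_nat_seg by blast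
  define y where "y e i = x i + e * real (Suc (h i))" for e i
  have "\<forall>\<^sub>F e in at 0. \<forall>i\<in>S. y e i \<noteq> 0"
  proof (intro eventually_ball_finite fin ballI)
    fix i
    show "\<forall>\<^sub>F e in at 0. y e i \<noteq> 0"
      by (rule eventually_mono[OF eventually_neq_at_within[of "- x i / real (Suc (h i))"]])
         (simp add: y_def field_simps add_eq_0_iff2 del: of_nat_Suc)
  qed
  moreover have "\<forall>\<^sub>F e in at 0. \<forall>i\<in>S. \<forall>j\<in>S. i \<noteq> j \<longrightarrow> y e i \<noteq> y e j"
  proof (intro eventually_ball_finite fin ballI)
    fix i j assume ij: "i \<in> S" "j \<in> S"
    show "\<forall>\<^sub>F e in at 0. i \<noteq> j \<longrightarrow> y e i \<noteq> y e j"
    proof (cases "i = j")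
      case False
      hence "real (h i) - real (h j) \<noteq> 0" using h ij by (auto simp: inj_on_def)
      thus ?thesis
        by (intro eventually_mono[OF eventually_neq_at_within[of "(x j - x i) / (real (h i) - real (h j))"]])
           (auto simp: y_def field_simps)
    qed simp
  qed
  ultimately have ev: "\<forall>\<^sub>F e in at 0. esym S k (y e) * esym S (Suc (Suc k)) (y e) \<le> (esym S (Suc k) (y e))\<^sup>2"
    by eventually_elim (rule newton_inequality_distinct[OF fin], auto simp: inj_on_def)
  have "((\<lambda>e. y e i) \<longlongrightarrow> x i) (at 0)" for i
    unfolding y_def by (rule tendsto_eq_intros refl | simp)+
  thus ?thesis
    by (intro tendsto_le[OF _ _ _ ev] tendsto_intros) auto
qed

text \<open>Partial derivatives are positive on the cone. If \<open>?b\<close> were nonpositive, the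
  recursions \<open>0 < ?b + x i * ?a\<close> and \<open>0 < ?c + x i * ?b\<close> would make
  \<open>?a * ?c\<close> exceed the square of \<open>?b\<close>, against Newton's
  inequality.\<close>

lemma esym_remove_pos:
  assumes fin: "finite S" and i: "i \<in> S"
  shows "\<forall>j\<le>Suc k. 0 < esym S j x \<Longrightarrow> \<forall>j\<le>k. 0 < esym (S - {i}) j x"
proof (induction k)
  case 0
  thus ?case using fin by simp
next
  case (Suc k)
  hence IH: "\<forall>j\<le>k. 0 < esym (S - {i}) j x" by simp
  let ?a = "esym (S - {i}) k x" and ?b = "esym (S - {i}) (Suc k) x" and ?c = "esym (S - {i}) (Suc (Suc k)) x"
  have a: "?a > 0" using IH by simp
  have "0 < esym S (Suc k) x" "0 < esym S (Suc (Suc k)) x" using Suc.prems by auto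
  hence 1: "0 < ?b + x i * ?a" and 2: "0 < ?c + x i * ?b"
    by (simp_all only: esym_remove[OF fin i])
  have N: "?a * ?c \<le> ?b\<^sup>2" using newton_inequality[of "S - {i}" k x] fin by simp
  have "?b > 0"
  proof (rule ccontr)
    assume "\<not> ?b > 0"
    hence b: "- ?b \<ge> 0" by simp
    have "?b\<^sup>2 = (- ?b) * (- ?b)" by (simp add: power2_eq_square)
    also have "\<dots> \<le> (x i * ?a) * (- ?b)"
      by (rule mult_right_mono) (use 1 b in auto)
    also have "\<dots> = ?a * (- (x i * ?b))" by simp
    also have "\<dots> < ?a * ?c" by (rule mult_strict_left_mono) (use 2 a in auto)
    finally show False using N by simp
  qed
  thus ?case using IH by (auto simp: le_Suc_eq)
qed

section \<open>Superadditivity of quotients of consecutive elementary symmetric polynomials\<close>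

definition esym_ratio :: "'a set \<Rightarrow> nat \<Rightarrow> ('a \<Rightarrow> real) \<Rightarrow> real" where
  "esym_ratio S j x = esym S (Suc j) x / esym S j x"

lemma esym_ratio_0 [simp]: "finite S \<Longrightarrow> esym_ratio S 0 x = sum x S"
  by (simp add: esym_ratio_def esym_1)

text \<open>A recursion suited to induction on \<open>k\<close>: what is subtracted from the linear
  term is a sum of squares over positive denominators, and these involve only quotients of lower
  order. It is Euler's identity combined with \<open>x i + esym_ratio (S - {i}) k x = esym S (Suc k)
  x / esym (S - {i}) k x\<close>.\<close>

lemma esym_ratio_Suc:
  assumes fin: "finite S" and pos: "\<forall>j\<le>Suc k. 0 < esym S j x"
  shows "real (Suc (Suc k)) * esym_ratio S (Suc k) x =
    sum x S - (\<Sum>i\<in>S. (x i)\<^sup>2 / (x i + esym_ratio (S - {i}) k x))"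
    and "i \<in> S \<Longrightarrow> 0 < x i + esym_ratio (S - {i}) k x"
proof -
  have key: "x i + esym_ratio (S - {i}) k x = esym S (Suc k) x / esym (S - {i}) k x \<and>
      0 < esym (S - {i}) k x" if "i \<in> S" for i
  proof -
    have "0 < esym (S - {i}) k x" using esym_remove_pos[OF fin that pos] by blast
    thus ?thesis by (simp add: esym_ratio_def esym_remove[OF fin that] field_simps)
  qed
  thus "i \<in> S \<Longrightarrow> 0 < x i + esym_ratio (S - {i}) k x"
    using pos by simp
  have p: "0 < esym S (Suc k) x" using pos by simp
  have "real (Suc (Suc k)) * esym_ratio S (Suc k) x = (\<Sum>i\<in>S. x i * esym (S - {i}) (Suc k) x / esym S (Suc k) x)"
    by (simp only: esym_ratio_def times_divide_eq_right sum_mult_esym_remove[OF fin, symmetric] sum_divide_distrib)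
  also have "\<dots> = (\<Sum>i\<in>S. x i - (x i)\<^sup>2 / (x i + esym_ratio (S - {i}) k x))"
  proof (intro sum.cong refl)
    fix i assume i: "i \<in> S"
    have e: "esym (S - {i}) (Suc k) x = esym S (Suc k) x - x i * esym (S - {i}) k x"
      using esym_remove[OF fin i] by simp
    show "x i * esym (S - {i}) (Suc k) x / esym S (Suc k) x = x i - (x i)\<^sup>2 / (x i + esym_ratio (S - {i}) k x)"
      unfolding e conjunct1[OF key[OF i]] using key[OF i] p by (simp add: field_simps power2_eq_square)
  qed
  finally show "real (Suc (Suc k)) * esym_ratio S (Suc k) x =
    sum x S - (\<Sum>i\<in>S. (x i)\<^sup>2 / (x i + esym_ratio (S - {i}) k x))"
    by (simp add: sum_subtractf)
qed

text \<open>Joint convexity and homogeneity of \<open>u^2 / a\<close>; for \<open>c = a + b\<close>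
  the gap is a square over a positive denominator.\<close>

lemma square_over_linear_subadditive:
  fixes u v a b c :: real
  assumes "0 < a" "0 < b" "a + b \<le> c"
  shows "(u + v)\<^sup>2 / c \<le> u\<^sup>2 / a + v\<^sup>2 / b"
proof -
  have "(u + v)\<^sup>2 / c \<le> (u + v)\<^sup>2 / (a + b)"
    by (rule divide_left_mono) (use assms in auto)
  also have "(u + v)\<^sup>2 / (a + b) \<le> u\<^sup>2 / a + v\<^sup>2 / b"
  proof -
    have "u\<^sup>2 / a + v\<^sup>2 / b - (u + v)\<^sup>2 / (a + b) = (u * b - v * a)\<^sup>2 / (a * b * (a + b))"
      using assms by (simp add: field_simps power2_eq_square add_pos_pos pos_add_strict less_imp_neq[symmetric])
    also have "\<dots> \<ge> 0" using assms by simp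
    finally show ?thesis by simp
  qed
  finally show ?thesis .
qed

text \<open>The Marcus--Lopes inequality; convexity of the cone comes out of the same induction.\<close>

lemma esym_ratio_superadditive:
  assumes "finite S" "\<forall>j\<le>Suc k. 0 < esym S j x" "\<forall>j\<le>Suc k. 0 < esym S j y"
  shows "(\<forall>j\<le>Suc k. 0 < esym S j (\<lambda>i. x i + y i)) \<and>
    esym_ratio S k x + esym_ratio S k y \<le> esym_ratio S k (\<lambda>i. x i + y i)"
  using assms
proof (induction k arbitrary: S)
  case 0
  have "0 < sum x S" "0 < sum y S"
    using 0 by (auto simp: esym_1[symmetric])
  thus ?case using 0 by (auto simp: le_Suc_eq esym_1 sum.distrib)
next
  case (Suc k)
  note fin = Suc.prems(1)
  let ?z = "\<lambda>i. x i + y i"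
  have x: "\<forall>j\<le>Suc k. 0 < esym S j x" and y: "\<forall>j\<le>Suc k. 0 < esym S j y"
    using Suc.prems by auto
  have z: "\<forall>j\<le>Suc k. 0 < esym S j ?z" using Suc.IH[OF fin x y] by blast
  have le: "(?z i)\<^sup>2 / (?z i + esym_ratio (S - {i}) k ?z) \<le>
      (x i)\<^sup>2 / (x i + esym_ratio (S - {i}) k x) + (y i)\<^sup>2 / (y i + esym_ratio (S - {i}) k y)"
    if i: "i \<in> S" for i
  proof (rule square_over_linear_subadditive)
    show "0 < x i + esym_ratio (S - {i}) k x" "0 < y i + esym_ratio (S - {i}) k y"
      by (rule esym_ratio_Suc(2)[OF fin x i] esym_ratio_Suc(2)[OF fin y i])+
    show "x i + esym_ratio (S - {i}) k x + (y i + esym_ratio (S - {i}) k y) \<le> ?z i + esym_ratio (S - {i}) k ?z"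
      using Suc.IH[of "S - {i}"] esym_remove_pos[OF fin i] Suc.prems by auto
  qed
  have sum_le: "(\<Sum>i\<in>S. (?z i)\<^sup>2 / (?z i + esym_ratio (S - {i}) k ?z)) \<le>
      (\<Sum>i\<in>S. (x i)\<^sup>2 / (x i + esym_ratio (S - {i}) k x) + (y i)\<^sup>2 / (y i + esym_ratio (S - {i}) k y))"
    by (rule sum_mono) (rule le)
  have "real (Suc (Suc k)) * (esym_ratio S (Suc k) x + esym_ratio S (Suc k) y) \<le>
      real (Suc (Suc k)) * esym_ratio S (Suc k) ?z"
    unfolding distrib_left esym_ratio_Suc(1)[OF fin x] esym_ratio_Suc(1)[OF fin y] esym_ratio_Suc(1)[OF fin z]
    using sum_le by (simp add: sum.distrib)
  hence sup: "esym_ratio S (Suc k) x + esym_ratio S (Suc k) y \<le> esym_ratio S (Suc k) ?z"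
    by (simp only: mult_le_cancel_left_pos of_nat_0_less_iff zero_less_Suc)
  \<comment> \<open>Superadditivity makes the top quotient of the sum positive; multiplied by its
    positive denominator it yields the one cone condition still missing.\<close>
  have "0 < esym_ratio S (Suc k) x" "0 < esym_ratio S (Suc k) y"
    using Suc.prems by (auto simp: esym_ratio_def)
  hence "0 < esym_ratio S (Suc k) ?z" using sup by simp
  moreover have "0 < esym S (Suc k) ?z" using z by blast
  ultimately have "0 < esym S (Suc (Suc k)) ?z" by (simp add: esym_ratio_def zero_less_divide_iff)
  thus ?case using z sup by (auto simp: le_Suc_eq)
qed

lemma esym_eq_prod_ratio:
  assumes "finite S" "\<forall>j<k. esym S j x \<noteq> 0"
  shows "esym S k x = (\<Prod>j<k. esym_ratio S j x)"
  using assms by (induction k) (simp_all add: esym_ratio_def field_simps)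

section \<open>Garding's inequality on the open and the closed cone\<close>

lemma DERIV_esym:
  assumes "finite S"
  shows "((\<lambda>t. esym S (Suc j) (\<lambda>i. x i + t * y i)) has_field_derivative
    (\<Sum>i\<in>S. y i * esym (S - {i}) j x)) (at 0)"
proof -
  have "((\<lambda>t. esym S (Suc j) (\<lambda>i. x i + t * y i)) has_field_derivative
     (\<Sum>I | I \<subseteq> S \<and> card I = Suc j. \<Sum>i\<in>I. y i * (\<Prod>m\<in>I - {i}. x m + 0 * y m))) (at 0)"
    unfolding esym_def
    by (intro DERIV_sum has_field_derivative_prod) (auto intro!: derivative_eq_intros)
  also have "(\<Sum>I | I \<subseteq> S \<and> card I = Suc j. \<Sum>i\<in>I. y i * (\<Prod>m\<in>I - {i}. x m + 0 * y m)) =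
      (\<Sum>i\<in>S. y i * esym (S - {i}) j x)"
    using sum_subsets_pick[OF assms, where f = "\<lambda>i J. y i * (\<Prod>m\<in>J. x m)" and j = j]
    by (simp add: esym_def sum_distrib_left)
  finally show ?thesis .
qed

text \<open>Along the ray \<open>x + t * y\<close>, superadditivity bounds \<open>esym\<close> below
  by the product of the \<open>a j + t * b j\<close>, with equality at \<open>t = 0\<close>. Hence
  the derivatives at 0 compare as \<open>P \<le> D\<close>, and \<open>P\<close> is
  \<open>esym S (Suc k) x\<close> times the sum of the \<open>b j / a j\<close>, to which the
  arithmetic-geometric mean inequality applies.\<close>

lemma garding_inequality_pos:
  assumes fin: "finite S" and x: "\<forall>j\<le>Suc k. 0 < esym S j x" and y: "\<forall>j\<le>Suc k. 0 < esym S j y"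
  shows "real (Suc k) * root (Suc k) (esym S (Suc k) y) * root (Suc k) (esym S (Suc k) x) ^ k
    \<le> (\<Sum>i\<in>S. y i * esym (S - {i}) k x)"
proof -
  let ?n = "Suc k"
  define a where "a j = esym_ratio S j x" for j
  define b where "b j = esym_ratio S j y" for j
  have a: "0 < a j" and b: "0 < b j" if "j < ?n" for j
    using x y that by (simp_all add: a_def b_def esym_ratio_def)
  have prod: "esym S ?n z = (\<Prod>j<?n. esym_ratio S j z)" if "\<forall>j\<le>?n. 0 < esym S j z" for z
    by (rule esym_eq_prod_ratio[OF fin]) (use that in \<open>auto simp: less_imp_neq[symmetric]\<close>)
  have lower: "(\<Prod>j<?n. a j + t * b j) \<le> esym S ?n (\<lambda>i. x i + t * y i)" if t: "0 < t" for t
  proof -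
    have ty: "\<forall>j\<le>?n. 0 < esym S j (\<lambda>i. t * y i)" using y t by (simp add: esym_scale)
    have br: "t * b j = esym_ratio S j (\<lambda>i. t * y i)" for j
      using t by (simp add: b_def esym_ratio_def esym_scale)
    have sup: "(\<forall>i\<le>Suc j. 0 < esym S i (\<lambda>i. x i + t * y i)) \<and>
        a j + t * b j \<le> esym_ratio S j (\<lambda>i. x i + t * y i)" if "j < ?n" for j
      unfolding br unfolding a_def
      by (rule esym_ratio_superadditive[OF fin]) (use x ty that in auto)
    hence "\<forall>j\<le>?n. 0 < esym S j (\<lambda>i. x i + t * y i)" by blast
    from prod[OF this] show ?thesis
      using sup a b t by (auto intro!: prod_mono simp del: prod.lessThan_Suc simp: less_imp_le)
  qed
  define D where "D = (\<Sum>i\<in>S. y i * esym (S - {i}) k x)"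
  define P where "P = (\<Sum>j<?n. b j * (\<Prod>m\<in>{..<?n} - {j}. a m + 0 * b m))"
  let ?g = "\<lambda>t. esym S ?n (\<lambda>i. x i + t * y i) - (\<Prod>j<?n. a j + t * b j)"
  have "(?g has_field_derivative D - P) (at 0)"
    unfolding D_def P_def
    by (intro DERIV_diff DERIV_esym fin has_field_derivative_prod) (auto intro!: derivative_eq_intros)
  moreover have "?g 0 = 0" using prod[OF x] by (simp add: a_def)
  moreover have "?g t \<ge> 0" if "0 < t" for t using lower[OF that] by simp
  \<comment> \<open>A negative derivative at 0 would make \<open>?g\<close> negative immediately to
    the right of 0.\<close>
  ultimately have PD: "P \<le> D"
    using DERIV_neg_dec_right[of ?g "D - P" 0] dense[of "0 :: real"] by (force simp: not_less)
  have e: "esym S ?n x = (\<Prod>j<?n. a j)" "esym S ?n y = (\<Prod>j<?n. b j)"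
    using prod[OF x] prod[OF y] by (simp_all add: a_def b_def)
  have "(\<Prod>j<?n. b j / a j) powr (1 / ?n) \<le> (\<Sum>j<?n. b j / a j / ?n)"
    using arith_geom_mean[of "{..<?n}" "\<lambda>j. b j / a j"] a b less_imp_le[OF divide_pos_pos]
    by (auto simp: lessThan_empty_iff simp del: prod.lessThan_Suc sum.lessThan_Suc of_nat_Suc)
  moreover have "0 < (\<Prod>j<?n. b j / a j)"
    using a b by (intro prod_pos) auto
  ultimately have "root ?n (\<Prod>j<?n. b j / a j) \<le> (\<Sum>j<?n. b j / a j / ?n)"
    by (subst root_powr_inverse) (simp_all del: prod.lessThan_Suc sum.lessThan_Suc of_nat_Suc)
  hence "root ?n (esym S ?n y / esym S ?n x) \<le> (\<Sum>j<?n. b j / a j) / ?n"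
    unfolding e by (simp only: prod_dividef sum_divide_distrib)
  hence "?n * root ?n (esym S ?n y / esym S ?n x) \<le> (\<Sum>j<?n. b j / a j)"
    by (simp only: pos_le_divide_eq of_nat_0_less_iff zero_less_Suc mult.commute)
  hence "esym S ?n x * (?n * root ?n (esym S ?n y / esym S ?n x)) \<le> esym S ?n x * (\<Sum>j<?n. b j / a j)"
    by (rule mult_left_mono) (use x in \<open>simp add: less_imp_le\<close>)
  also have "esym S ?n x * (\<Sum>j<?n. b j / a j) = P"
    unfolding P_def e sum_distrib_left
  proof (intro sum.cong refl)
    fix j assume j: "j \<in> {..<?n}"
    have "(\<Prod>j<?n. a j) = a j * (\<Prod>m\<in>{..<?n} - {j}. a m)"
      by (rule prod.remove) (use j in auto)
    thus "(\<Prod>j<?n. a j) * (b j / a j) = b j * (\<Prod>m\<in>{..<?n} - {j}. a m + 0 * b m)"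
      using a[of j] j by (simp del: prod.lessThan_Suc)
  qed
  also have "esym S ?n x * (?n * root ?n (esym S ?n y / esym S ?n x)) =
      real ?n * root ?n (esym S ?n y) * root ?n (esym S ?n x) ^ k"
  proof -
    have pos: "0 < esym S ?n x" using x by simp
    define r where "r = root ?n (esym S ?n x)"
    have r: "r > 0" "esym S ?n x = r ^ ?n"
      unfolding r_def using pos by (simp_all add: real_root_pow_pos2 del: power_Suc)
    show ?thesis
      unfolding real_root_divide r_def[symmetric] using r by (simp add: field_simps)
  qed
  finally show ?thesis using PD by (simp add: D_def)
qed

text \<open>All terms of the shift expansion are nonnegative, and the term \<open>m = 0\<close> is
  positive because \<open>j \<le> card S\<close>.\<close>

lemma esym_shift_pos:
  assumes "finite S" "k \<le> card S" "\<forall>j\<le>k. 0 \<le> esym S j x" "0 < c"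
  shows "\<forall>j\<le>k. 0 < esym S j (\<lambda>i. x i + c)"
proof (intro allI impI)
  fix j assume j: "j \<le> k"
  have "0 < real ((card S - 0) choose (j - 0)) * c ^ (j - 0) * esym S 0 x"
    using assms j by simp
  also have "\<dots> \<le> (\<Sum>m\<le>j. real ((card S - m) choose (j - m)) * c ^ (j - m) * esym S m x)"
    by (rule member_le_sum) (use assms j in auto)
  finally show "0 < esym S j (\<lambda>i. x i + c)"
    using esym_shift[OF assms(1)] by simp
qed

text \<open>Shifting both points by \<open>c > 0\<close> moves them into the open cone; then
  \<open>c\<close> decreases to 0.\<close>

lemma garding_inequality:
  assumes fin: "finite S" and k: "Suc k \<le> card S"
    and x: "\<forall>j\<le>Suc k. 0 \<le> esym S j x" and y: "\<forall>j\<le>Suc k. 0 \<le> esym S j y"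
  shows "real (Suc k) * root (Suc k) (esym S (Suc k) y) * root (Suc k) (esym S (Suc k) x) ^ k
    \<le> (\<Sum>i\<in>S. y i * esym (S - {i}) k x)"
proof -
  let ?x = "\<lambda>c i. x i + c" and ?y = "\<lambda>c i. y i + c"
  have lim3: "\<forall>\<^sub>F c in at_right 0. real (Suc k) * root (Suc k) (esym S (Suc k) (?y c)) * root (Suc k) (esym S (Suc k) (?x c)) ^ k
    \<le> (\<Sum>i\<in>S. ?y c i * esym (S - {i}) k (?x c))"
    using garding_inequality_pos[OF fin esym_shift_pos[OF fin k x] esym_shift_pos[OF fin k y]]
    by (intro eventually_at_rightI[of 0 1]) auto
  have lim: "((\<lambda>c. ?x c i) \<longlongrightarrow> x i) (at_right 0)" "((\<lambda>c. ?y c i) \<longlongrightarrow> y i) (at_right 0)" for i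
    by (rule tendsto_eq_intros refl | simp)+
  show ?thesis
    by (intro tendsto_le[OF _ _ _ lim3] tendsto_mult tendsto_power tendsto_real_root tendsto_esym tendsto_sum
        tendsto_const lim) auto
qed

section \<open>The infimum over the cone\<close>

lemma esym_nonneg: "\<forall>i\<in>S. 0 \<le> x i \<Longrightarrow> 0 \<le> esym S j x"
  unfolding esym_def by (intro sum_nonneg prod_nonneg) auto

text \<open>Positivity descends from order \<open>Suc k\<close> to order \<open>k\<close>: Garding's
  inequality in the direction of the all-ones vector bounds a multiple of \<open>esym S k x\<close>
  below by a positive number.\<close>

lemma esym_closed_cone_pos:
  assumes fin: "finite S"
  shows "k \<le> card S \<Longrightarrow> \<forall>j\<le>k. 0 \<le> esym S j x \<Longrightarrow> 0 < esym S k x \<Longrightarrow> \<forall>j\<le>k. 0 < esym S j x"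
proof (induction k)
  case (Suc k)
  have "0 < esym S k x"
  proof (cases "k = 0")
    case False
    have "0 < real (Suc k) * root (Suc k) (esym S (Suc k) (\<lambda>_. 1)) * root (Suc k) (esym S (Suc k) x) ^ k"
      using Suc.prems fin
      by (intro mult_pos_pos zero_less_power) (simp_all add: esym_one real_root_gt_zero del: of_nat_Suc binomial_Suc_Suc)
    also have "\<dots> \<le> (\<Sum>i\<in>S. 1 * esym (S - {i}) k x)"
      by (rule garding_inequality[OF fin]) (use Suc.prems in \<open>auto intro: esym_nonneg\<close>)
    also have "\<dots> = real (card S - k) * esym S k x"
      by (simp add: sum_esym_remove fin)
    finally show ?thesis by (simp add: zero_less_mult_iff)
  qed (use fin in simp)
  thus ?case using Suc by (auto simp: le_Suc_eq)
qed (use fin in simp)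

lemma normalize_cone:
  assumes "\<forall>j\<le>Suc k. 0 < esym S j x"
  defines "r \<equiv> root (Suc k) (esym S (Suc k) x)"
  shows "0 < r" "esym S (Suc k) x = r ^ Suc k"
    "\<forall>j\<le>Suc k. 0 < esym S j (\<lambda>i. inverse r * x i)" "esym S (Suc k) (\<lambda>i. inverse r * x i) = 1"
proof -
  have pos: "0 < esym S (Suc k) x" using assms(1) by blast
  show r: "0 < r" "esym S (Suc k) x = r ^ Suc k"
    unfolding r_def using pos by (simp_all add: real_root_pow_pos2 del: power_Suc)
  show "\<forall>j\<le>Suc k. 0 < esym S j (\<lambda>i. inverse r * x i)"
    using assms(1) r(1) by (simp add: esym_scale)
  show "esym S (Suc k) (\<lambda>i. inverse r * x i) = 1"
    using r by (simp add: esym_scale power_inverse del: power_Suc)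
qed

lemma garding_bound_approx:
  assumes fin: "finite S" and k: "Suc k \<le> card S" and l: "\<forall>j\<le>Suc k. 0 \<le> esym S j l" and e: "0 < e"
  shows "\<exists>g. (\<forall>j\<le>Suc k. 0 < esym S j g) \<and> esym S (Suc k) g = 1 \<and>
    (\<Sum>i\<in>S. l i * esym (S - {i}) k g) < real (Suc k) * root (Suc k) (esym S (Suc k) l) + e"
proof -
  let ?f = "\<lambda>c. real (Suc k) * root (Suc k) (esym S (Suc k) (\<lambda>i. l i + c))"
  have "((\<lambda>c. l i + c) \<longlongrightarrow> l i) (at_right 0)" for i
    by (rule tendsto_eq_intros refl | simp)+
  hence "(?f \<longlongrightarrow> real (Suc k) * root (Suc k) (esym S (Suc k) l)) (at_right 0)"
    by (intro tendsto_mult tendsto_const tendsto_real_root tendsto_esym)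
  hence "\<forall>\<^sub>F c in at_right 0. ?f c < real (Suc k) * root (Suc k) (esym S (Suc k) l) + e"
    by (rule order_tendstoD) (use e in simp)
  moreover have "\<forall>\<^sub>F c in at_right 0. (0::real) < c" by (rule eventually_at_right_less)
  ultimately obtain c where c: "?f c < real (Suc k) * root (Suc k) (esym S (Suc k) l) + e" "0 < c"
    using eventually_happens[OF eventually_conj] trivial_limit_at_right_real by blast
  define x where "x = (\<lambda>i. l i + c)"
  define r where "r = root (Suc k) (esym S (Suc k) x)"
  have x: "\<forall>j\<le>Suc k. 0 < esym S j x"
    unfolding x_def by (rule esym_shift_pos[OF fin k l c(2)])
  note n = normalize_cone[OF x, folded r_def]
  have "(\<Sum>i\<in>S. l i * esym (S - {i}) k (\<lambda>i. inverse r * x i)) = inverse r ^ k * (\<Sum>i\<in>S. l i * esym (S - {i}) k x)"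
    by (simp add: esym_scale sum_distrib_left mult_ac)
  \<comment> \<open>Since the partial derivatives are positive, replacing \<open>l i\<close> by
    \<open>x i = l i + c\<close> only enlarges the sum, and Euler's identity evaluates the
    result.\<close>
  also have "\<dots> \<le> inverse r ^ k * (\<Sum>i\<in>S. x i * esym (S - {i}) k x)"
    using n(1) c(2) esym_remove_pos[OF fin _ x]
    by (intro mult_left_mono sum_mono mult_right_mono) (auto simp: x_def less_imp_le)
  also have "\<dots> = real (Suc k) * r"
    unfolding sum_mult_esym_remove[OF fin] n(2) using n(1) by (simp add: power_inverse field_simps)
  also have "\<dots> < real (Suc k) * root (Suc k) (esym S (Suc k) l) + e"
    using c(1) by (simp add: r_def x_def)
  finally show ?thesis using n(3,4) by blast
qed

section \<open>Unboundedness from below outside the closed cone\<close>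

lemma esym_single_block:
  assumes fin: "finite S" and T: "T \<subseteq> S" and pos: "\<forall>i\<in>T. 0 < x i" and z: "\<forall>i\<in>S - T. x i = 0"
  shows "\<forall>j\<le>card T. 0 < esym S j x" "esym S (card T) x = (\<Prod>i\<in>T. x i)"
    "\<forall>J\<subseteq>T. (\<Prod>i\<in>J. x i) \<le> esym S (card J) x"
proof -
  have nn: "0 \<le> x i" if "i \<in> S" for i
    using that pos z by (cases "i \<in> T") (auto simp: less_imp_le)
  have finT: "finite T" by (rule finite_subset[OF T fin])
  show le: "\<forall>J\<subseteq>T. (\<Prod>i\<in>J. x i) \<le> esym S (card J) x"
    unfolding esym_def
    using T nn by (auto intro!: member_le_sum prod_nonneg finite_subsets_card fin)
  show "\<forall>j\<le>card T. 0 < esym S j x"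
  proof (intro allI impI)
    fix j assume "j \<le> card T"
    then obtain J where J: "J \<subseteq> T" "card J = j" using obtain_subset_with_card_n by metis
    have "0 < (\<Prod>i\<in>J. x i)" using J pos by (intro prod_pos) auto
    also have "\<dots> \<le> esym S (card J) x" using le J(1) by blast
    finally show "0 < esym S j x" by (simp only: J(2))
  qed
  have "(\<Prod>i\<in>I. x i) = 0" if "I \<subseteq> S" "card I = card T" "I \<noteq> T" for I
  proof -
    have "finite I" using that fin finite_subset by blast
    moreover have "\<not> I \<subseteq> T" using that card_subset_eq[OF finT] by blast
    ultimately show ?thesis using that z by (intro prod_zero) auto
  qed
  hence "(\<Sum>I\<in>{I. I \<subseteq> S \<and> card I = card T} - {T}. \<Prod>i\<in>I. x i) = 0"
    by (intro sum.neutral) auto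
  thus "esym S (card T) x = (\<Prod>i\<in>T. x i)"
    unfolding esym_def using T by (subst sum.remove[of _ T]) (auto intro: finite_subsets_card fin)
qed

text \<open>The witness has \<open>k\<close> entries \<open>t\<close>, one entry
  \<open>inverse (t ^ k)\<close> and zeros elsewhere. Only one subset of size \<open>Suc k\<close>
  has a nonzero product, namely 1, while the \<open>k\<close> large entries alone contribute
  \<open>t ^ k\<close> to \<open>esym S k\<close>.\<close>

lemma esym_unbounded_on_level:
  assumes fin: "finite S" and k: "Suc k \<le> card S" "1 \<le> k"
  shows "\<exists>g. (\<forall>j\<le>Suc k. 0 < esym S j g) \<and> esym S (Suc k) g = 1 \<and> C \<le> esym S k g"
proof -
  obtain T where T: "T \<subseteq> S" "card T = Suc k" "finite T"
    using obtain_subset_with_card_n[OF k(1)] by metis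
  then obtain a where a: "a \<in> T" by fastforce
  have ca: "card (T - {a}) = k" using T a by simp
  define t where "t = max 1 C"
  define x where "x i = (if i = a then inverse (t ^ k) else if i \<in> T then t else 0)" for i
  have t: "t \<ge> 1" "t \<ge> C" by (auto simp: t_def)
  have p: "(\<Prod>i\<in>T - {a}. x i) = t ^ k"
    using ca by (subst prod.cong[OF refl, where h = "\<lambda>_. t"]) (auto simp: x_def)
  have pos: "\<forall>i\<in>T. 0 < x i" using t by (auto simp: x_def)
  have "\<forall>i\<in>S - T. x i = 0" using a by (auto simp: x_def)
  note b = esym_single_block[OF fin T(1) pos this]
  have "(\<Prod>i\<in>T. x i) = 1"
    using prod.remove[OF T(3) a, of x] p t by (simp add: x_def)
  moreover have "t ^ k \<le> esym S k x" using b(3) p ca by (metis Diff_subset)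
  moreover have "t \<le> t ^ k" using t(1) k(2) self_le_power[of t k] by simp
  ultimately show ?thesis using b(1,2) T(2) t(2) by (intro exI[of _ x]) auto
qed

text \<open>The right side is \<open>c\<close> times the derivative of the left side in
  \<open>c\<close>. A polynomial \<open>f\<close> in \<open>c\<close> with nonnegative coefficients
  and no constant term satisfies \<open>f c \<le> c * f' c\<close> term by term.\<close>

lemma esym_le_shift_derivative:
  assumes fin: "finite S" and k: "Suc k \<le> card S" and x: "\<forall>j\<le>k. 0 \<le> esym S j x" "esym S (Suc k) x = 0"
    and c: "0 \<le> c"
  shows "esym S (Suc k) (\<lambda>i. x i + c) \<le> c * (real (card S - k) * esym S k (\<lambda>i. x i + c))"
proof -
  let ?n = "card S"
  have "esym S (Suc k) (\<lambda>i. x i + c) =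
      (\<Sum>m\<le>k. real ((?n - m) choose (Suc k - m)) * c ^ (Suc k - m) * esym S m x)"
    by (simp add: esym_shift[OF fin] x(2))
  also have "\<dots> \<le> (\<Sum>m\<le>k. real (?n - k) * real ((?n - m) choose (k - m)) * c ^ (Suc k - m) * esym S m x)"
  proof (intro sum_mono mult_right_mono)
    fix m assume m: "m \<in> {..k}"
    hence eq: "Suc k - m = Suc (k - m)" "?n - m - (k - m) = ?n - k" using k by auto
    \<comment> \<open>The absorption identity; the factor \<open>Suc (k - m)\<close>, at least 1, is
      the exponent brought down by differentiation.\<close>
    have "Suc (k - m) * ((?n - m) choose Suc (k - m)) = (?n - k) * ((?n - m) choose (k - m))"
      using binomial_absorb_comp[of "?n - m" "k - m"] binomial_absorption[of "k - m" "?n - m"] eq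
      by (metis Suc_times_binomial_eq binomial_absorption mult.commute)
    moreover have "((?n - m) choose Suc (k - m)) \<le> Suc (k - m) * ((?n - m) choose Suc (k - m))" by simp
    ultimately have "((?n - m) choose (Suc k - m)) \<le> (?n - k) * ((?n - m) choose (k - m))"
      unfolding eq by simp
    thus "real ((?n - m) choose (Suc k - m)) \<le> real (?n - k) * real ((?n - m) choose (k - m))"
      by (metis of_nat_le_iff of_nat_mult)
  qed (use x c in auto)
  also have "\<dots> = c * (real (?n - k) * esym S k (\<lambda>i. x i + c))"
    unfolding esym_shift[OF fin] sum_distrib_left
    by (intro sum.cong refl) (auto simp: Suc_diff_le)
  finally show ?thesis .
qed

lemma garding_functional_unbounded:
  assumes fin: "finite S" and k: "Suc k \<le> card S" "1 \<le> k" and l: "\<not> (\<forall>j\<le>Suc k. 0 \<le> esym S j l)"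
  shows "\<exists>g. (\<forall>j\<le>Suc k. 0 < esym S j g) \<and> esym S (Suc k) g = 1 \<and>
    (\<Sum>i\<in>S. l i * esym (S - {i}) k g) < C"
proof (rule ccontr)
  assume contra: "\<not> ?thesis"
  define K where "K = max 0 (- C)"
  have norm_bd: "- K \<le> (\<Sum>i\<in>S. l i * esym (S - {i}) k g)"
    if "\<forall>j\<le>Suc k. 0 < esym S j g" "esym S (Suc k) g = 1" for g
    using contra that by (force simp: K_def not_less)
  \<comment> \<open>The functional is homogeneous of degree \<open>k\<close> in \<open>x\<close>, so
    the bound extends from the level set to the whole cone.\<close>
  have bd: "- K * root (Suc k) (esym S (Suc k) x) ^ k \<le> (\<Sum>i\<in>S. l i * esym (S - {i}) k x)"
    if x: "\<forall>j\<le>Suc k. 0 < esym S j x" for x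
  proof -
    define r where "r = root (Suc k) (esym S (Suc k) x)"
    note n = normalize_cone[OF x, folded r_def]
    have "- K \<le> inverse r ^ k * (\<Sum>i\<in>S. l i * esym (S - {i}) k x)"
      using norm_bd[OF n(3,4)] by (simp add: esym_scale sum_distrib_left mult_ac)
    thus ?thesis
      unfolding r_def[symmetric] using n(1) by (simp add: power_inverse field_simps)
  qed
  \<comment> \<open>The diagonal shifts that take \<open>l\<close> into the closed cone.
    \<open>T\<close> is closed, contains the sum of the \<open>\<bar>l i\<bar>\<close> and omits 0,
    so its infimum \<open>s\<close> is attained and positive.\<close>
  define T where "T = {s. 0 \<le> s \<and> (\<forall>j\<le>Suc k. 0 \<le> esym S j (\<lambda>i. l i + s))}"
  have cont: "continuous_on U (\<lambda>s. esym S j (\<lambda>i. l i + s))" for j U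
    by (intro continuous_intros fin)
  have "T = {0..} \<inter> (\<Inter>j\<in>{..Suc k}. {s. 0 \<le> esym S j (\<lambda>i. l i + s)})"
    by (auto simp: T_def)
  also have "closed \<dots>"
    by (intro closed_Int closed_INT ballI closed_Collect_le cont continuous_intros)
  finally have closedT: "closed T" .
  have neT: "T \<noteq> {}"
  proof -
    have "0 \<le> l i + (\<Sum>i\<in>S. \<bar>l i\<bar>)" if "i \<in> S" for i
      using member_le_sum[OF that _ fin, of "\<lambda>i. \<bar>l i\<bar>"] by simp
    hence "(\<Sum>i\<in>S. \<bar>l i\<bar>) \<in> T"
      unfolding T_def by (auto intro!: esym_nonneg sum_nonneg)
    thus ?thesis by blast
  qed
  have bddT: "bdd_below T" by (auto simp: T_def bdd_below_def)
  define s where "s = Inf T"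
  have sT: "s \<in> T" unfolding s_def by (rule closed_contains_Inf[OF neT bddT closedT])
  have s: "0 < s"
  proof -
    have "0 \<notin> T" using l by (auto simp: T_def)
    thus ?thesis using sT by (auto simp: T_def less_le)
  qed
  define m where "m = (\<lambda>i. l i + s)"
  have m: "\<forall>j\<le>Suc k. 0 \<le> esym S j m" using sT by (simp add: T_def m_def)
  \<comment> \<open>Otherwise \<open>m\<close> would lie in the open cone, and slightly smaller
    shifts would still belong to \<open>T\<close>.\<close>
  have m0: "esym S (Suc k) m = 0"
  proof (rule ccontr)
    assume "esym S (Suc k) m \<noteq> 0"
    hence "0 < esym S (Suc k) m" using m by (simp add: less_le)
    hence pos: "\<forall>j\<le>Suc k. 0 < esym S j (\<lambda>i. l i + s)"
      using esym_closed_cone_pos[OF fin k(1) m] by (simp add: m_def)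
    have "((\<lambda>t. l i + t) \<longlongrightarrow> l i + s) (at_left s)" for i
      by (rule tendsto_eq_intros refl | simp)+
    hence "\<forall>\<^sub>F t in at_left s. \<forall>j\<in>{..Suc k}. 0 < esym S j (\<lambda>i. l i + t)"
      using pos by (intro eventually_ball_finite finite_atMost ballI order_tendstoD(1)[OF tendsto_esym]) auto
    moreover have "\<forall>\<^sub>F t in at_left s. t \<in> {0<..<s}"
      by (rule eventually_at_left_real[OF s])
    ultimately have "\<forall>\<^sub>F t in at_left s. t \<in> T \<and> t < s"
      by eventually_elim (auto simp: T_def less_imp_le)
    then obtain t where "t \<in> T" "t < s"
      using eventually_happens trivial_limit_at_left_real by blast
    thus False using cInf_lower[OF _ bddT, of t] by (simp add: s_def)
  qed
  have shift: "\<forall>j\<le>Suc k. 0 < esym S j (\<lambda>i. m i + c)" if "0 < c" for c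
    by (rule esym_shift_pos[OF fin k(1) m that])
  define n where "n = real (card S - k)"
  have n: "n \<ge> 1" using k by (simp add: n_def)
  define K' where "K' = (real (Suc k) + K) / s"
  \<comment> \<open>Here \<open>d\<close> is the diagonal derivative at \<open>?x = m + c\<close>.
    Writing \<open>l = ?x - (s + c)\<close> in \<open>bd\<close> and using \<open>r \<le> 1\<close>
    gives \<open>s * d \<le> (Suc k + K) * r ^ k\<close>. Together with
    \<open>r ^ Suc k \<le> c * d\<close> this bounds \<open>r\<close> by
    \<open>c * K'\<close>.\<close>
  have upper: "esym S (Suc k) (\<lambda>i. m i + c) \<le> (c * K') ^ Suc k"
    if c: "0 < c" and small: "esym S (Suc k) (\<lambda>i. m i + c) < 1" for c
  proof -
    let ?x = "\<lambda>i. m i + c"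
    define r where "r = root (Suc k) (esym S (Suc k) ?x)"
    define d where "d = n * esym S k ?x"
    note r = normalize_cone(1,2)[OF shift[OF c], folded r_def]
    have r1: "r \<le> 1" unfolding r_def using small by (simp add: real_root_le_1_iff)
    have d: "0 \<le> d" using shift[OF c] n by (simp add: d_def less_imp_le)
    have "- K * r ^ k \<le> (\<Sum>i\<in>S. l i * esym (S - {i}) k ?x)"
      using bd[OF shift[OF c]] by (simp add: r_def)
    also have "\<dots> = (\<Sum>i\<in>S. ?x i * esym (S - {i}) k ?x) - (s + c) * (\<Sum>i\<in>S. esym (S - {i}) k ?x)"
      by (simp add: m_def algebra_simps sum.distrib sum_distrib_left)
    also have "\<dots> = real (Suc k) * r ^ Suc k - (s + c) * d"
      by (simp only: sum_mult_esym_remove[OF fin] sum_esym_remove[OF fin] r(2) d_def n_def)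
    finally have "s * d + c * d \<le> real (Suc k) * (r * r ^ k) + K * r ^ k"
      by (simp add: algebra_simps)
    moreover have "real (Suc k) * (r * r ^ k) \<le> real (Suc k) * (1 * r ^ k)"
      using r r1 by (intro mult_left_mono mult_right_mono) auto
    ultimately have "s * d + c * d \<le> (real (Suc k) + K) * r ^ k"
      unfolding distrib_right by linarith
    hence "s * d \<le> (real (Suc k) + K) * r ^ k"
      using c d by (smt (verit) mult_nonneg_nonneg)
    hence d_le: "d \<le> K' * r ^ k" using s by (simp add: K'_def field_simps)
    have "r * r ^ k \<le> c * d"
      using esym_le_shift_derivative[OF fin k(1) _ m0, of c] m c r(2) by (simp add: d_def n_def)
    also have "\<dots> \<le> (c * K') * r ^ k" using d_le c by (simp add: mult.assoc mult_left_mono)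
    finally have "r \<le> c * K'" using r(1) by simp
    thus ?thesis unfolding r(2) using r(1) by (intro power_mono) auto
  qed
  \<comment> \<open>The term of the shift expansion linear in \<open>m\<close> carries only
    \<open>c ^ k\<close>, while the whole value is of order \<open>c ^ Suc k\<close>. Dividing and
    letting \<open>c\<close> tend to 0 leaves no room for a positive
    \<open>esym S 1 m\<close>.\<close>
  have "real ((card S - 1) choose k) * esym S 1 m \<le> c * K' ^ Suc k"
    if c: "0 < c" and small: "esym S (Suc k) (\<lambda>i. m i + c) < 1" for c
  proof -
    have "real ((card S - 1) choose (Suc k - 1)) * c ^ (Suc k - 1) * esym S 1 m \<le> esym S (Suc k) (\<lambda>i. m i + c)"
      unfolding esym_shift[OF fin]
      by (rule member_le_sum) (use m c in auto)
    also have "\<dots> \<le> (c * K') ^ Suc k" by (rule upper[OF that])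
    finally have "c ^ k * (real ((card S - 1) choose k) * esym S 1 m) \<le> c ^ k * (c * K' ^ Suc k)"
      by (simp add: power_mult_distrib mult_ac)
    thus ?thesis using c by simp
  qed
  moreover have "\<forall>\<^sub>F c in at_right 0. esym S (Suc k) (\<lambda>i. m i + c) < 1"
  proof -
    have "((\<lambda>t. m i + t) \<longlongrightarrow> m i) (at_right 0)" for i
      by (rule tendsto_eq_intros refl | simp)+
    thus ?thesis using m0 by (intro order_tendstoD(2)[OF tendsto_esym]) auto
  qed
  moreover have "\<forall>\<^sub>F c in at_right 0. (0::real) < c" by (rule eventually_at_right_less)
  ultimately have ev: "\<forall>\<^sub>F c in at_right 0. real ((card S - 1) choose k) * esym S 1 m \<le> c * K' ^ Suc k"
    by (auto elim: eventually_elim2)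
  have "((\<lambda>c. c * K' ^ Suc k) \<longlongrightarrow> 0) (at_right 0)"
    by (rule tendsto_eq_intros refl | simp)+
  hence "real ((card S - 1) choose k) * esym S 1 m \<le> 0"
    by (rule tendsto_lowerbound[OF _ ev]) simp
  moreover have "0 < (card S - 1) choose k" using k by simp
  ultimately have "esym S 1 m \<le> 0" by (simp add: mult_le_0_iff)
  hence "esym S 1 m = 0" using m k by (simp add: order_antisym)
  \<comment> \<open>As \<open>1 \<le> k\<close>, the cone conditions on \<open>m\<close> include
    order 2, so both summands are nonnegative and \<open>m\<close> vanishes on
    \<open>S\<close>.\<close>
  hence "(\<Sum>i\<in>S. (m i)\<^sup>2) + 2 * esym S 2 m = 0"
    using esym_2[OF fin, of m] esym_1[OF fin, of m] by simp
  moreover have "0 \<le> esym S 2 m" using m k by simp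
  moreover have "0 \<le> (\<Sum>i\<in>S. (m i)\<^sup>2)" by (simp add: sum_nonneg)
  ultimately have "(\<Sum>i\<in>S. (m i)\<^sup>2) = 0" by simp
  hence "\<forall>i\<in>S. m i = 0" using fin by (simp add: sum_nonneg_eq_0_iff)
  hence l_eq: "\<forall>i\<in>S. l i = - s" by (auto simp: m_def)
  \<comment> \<open>Now \<open>l\<close> is constantly \<open>- s\<close> on \<open>S\<close>, and
    the functional is \<open>- s * n * esym S k g\<close>; this \<open>g\<close> pushes it below
    \<open>- K\<close>.\<close>
  obtain g where g: "\<forall>j\<le>Suc k. 0 < esym S j g" "esym S (Suc k) g = 1" "(K + 1) / s \<le> esym S k g"
    using esym_unbounded_on_level[OF fin k] by blast
  have "- K \<le> (\<Sum>i\<in>S. - s * esym (S - {i}) k g)"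
    using norm_bd[OF g(1,2)] l_eq by simp
  also have "\<dots> = - s * (n * esym S k g)"
    by (simp only: sum_distrib_left[symmetric] sum_esym_remove[OF fin] n_def)
  also have "\<dots> \<le> - s * (1 * esym S k g)"
    using g(1) n s by (simp add: less_imp_le)
  also have "\<dots> \<le> - (K + 1)" using g(3) s by (simp add: field_simps)
  finally show False by simp
qed

section \<open>Diagonalisation and rearrangement\<close>

text \<open>If \<open>l\<close> is a decreasing function of \<open>d\<close>, then \<open>l\<close> is a supergradient of a concave function of
  \<open>d\<close>. Its values are linear programming duals certifying that the identity is the optimal
  assignment in the rearrangement inequality for doubly stochastic matrices.\<close>

lemma supergradient_potential:
  fixes d l :: "'a \<Rightarrow> real"
  assumes "finite S" "\<forall>i\<in>S. \<forall>j\<in>S. (d i - d j) * (l i - l j) \<le> 0"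
  shows "\<exists>f. \<forall>i\<in>S. \<forall>j\<in>S. f i - f j \<le> l j * (d i - d j)"
  using assms
proof (induction S rule: finite_psubset_induct)
  case (psubset S)
  show ?case
  proof (cases "S = {}")
    case False
    \<comment> \<open>Among the indices with the largest \<open>d\<close>, take one with the
      smallest \<open>l\<close>. By opposite ordering it minimises \<open>l\<close> over all of
      \<open>S\<close>, and it is the index removed in the induction.\<close>
    define S' where "S' = {i \<in> S. d i = Max (d ` S)}"
    have "Max (d ` S) \<in> d ` S" using psubset.hyps False by (intro Max_in) auto
    hence S': "finite S'" "S' \<noteq> {}" using psubset.hyps by (auto simp: S'_def)
    define m where "m = arg_min_on l S'"
    have "m \<in> S'" unfolding m_def by (rule arg_min_if_finite(1)[OF S'])
    hence m: "m \<in> S" "d m = Max (d ` S)" by (auto simp: S'_def)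
    have dm: "d j \<le> d m" if "j \<in> S" for j using m(2) that psubset.hyps by simp
    have lm: "l m \<le> l j" if j: "j \<in> S" for j
    proof (cases "d j = d m")
      case True
      hence "j \<in> S'" using j m by (simp add: S'_def)
      thus ?thesis unfolding m_def by (rule arg_min_least[OF S'])
    next
      case False
      hence "d m - d j > 0" using dm[OF j] by simp
      moreover have "(d m - d j) * (l m - l j) \<le> 0" using psubset.prems m(1) j by blast
      ultimately show ?thesis by (simp add: mult_le_0_iff)
    qed
    have "S - {m} \<subset> S" using m by blast
    then obtain f where f: "\<forall>i\<in>S - {m}. \<forall>j\<in>S - {m}. f i - f j \<le> l j * (d i - d j)"
      using psubset.IH[of "S - {m}"] psubset.prems by auto
    show ?thesis
    proof (cases "S = {m}")
      case False
      \<comment> \<open>The largest value at \<open>m\<close> compatible with the inequalities that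
        have \<open>i = m\<close>. Those with \<open>j = m\<close> then follow because
        \<open>l m\<close> is minimal and \<open>d m\<close> maximal.\<close>
      define v where "v = Min ((\<lambda>j. f j + l j * (d m - d j)) ` (S - {m}))"
      have fin: "finite ((\<lambda>j. f j + l j * (d m - d j)) ` (S - {m}))"
        and ne: "(\<lambda>j. f j + l j * (d m - d j)) ` (S - {m}) \<noteq> {}"
        using psubset.hyps False m by auto
      have v_le: "v \<le> f j + l j * (d m - d j)" if "j \<in> S - {m}" for j
        unfolding v_def using fin that by (intro Min_le) auto
      have v_ge: "f i + l m * (d m - d i) \<le> v" if i: "i \<in> S - {m}" for i
      proof -
        have "v \<in> (\<lambda>j. f j + l j * (d m - d j)) ` (S - {m})"
          unfolding v_def by (rule Min_in[OF fin ne])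
        then obtain j where j: "j \<in> S - {m}" "v = f j + l j * (d m - d j)" by blast
        have "l m * (d m - d i) \<le> l j * (d m - d i)"
          using lm dm i j by (intro mult_right_mono) auto
        moreover have "f i - f j \<le> l j * (d i - d j)" using f i j by blast
        ultimately show ?thesis unfolding j(2) by (simp add: algebra_simps)
      qed
      have "\<forall>i\<in>S. \<forall>j\<in>S. (f(m := v)) i - (f(m := v)) j \<le> l j * (d i - d j)"
        using f v_le v_ge by (auto simp: algebra_simps)
      thus ?thesis by blast
    qed auto
  qed auto
qed

text \<open>No transposition improves a minimising permutation \<open>p\<close>, so \<open>d\<close>
  and \<open>l (p _)\<close> are oppositely ordered and potentials \<open>f\<close> exist. Row and
  column sums equal to 1 allow the potentials to be inserted at no cost, after which the comparison
  holds entry by entry.\<close>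

lemma doubly_stochastic_rearrangement:
  fixes d l :: "'n::finite \<Rightarrow> real" and P :: "'n \<Rightarrow> 'n \<Rightarrow> real"
  assumes nonneg: "\<And>i j. 0 \<le> P i j" and row: "\<And>i. (\<Sum>j\<in>UNIV. P i j) = 1"
    and col: "\<And>j. (\<Sum>i\<in>UNIV. P i j) = 1"
  shows "\<exists>p. p permutes UNIV \<and> (\<Sum>i\<in>UNIV. d i * l (p i)) \<le> (\<Sum>i\<in>UNIV. \<Sum>j\<in>UNIV. P i j * d i * l j)"
proof -
  define F where "F p = (\<Sum>i\<in>UNIV. d i * l (p i))" for p :: "'n \<Rightarrow> 'n"
  let ?Q = "{p. p permutes (UNIV :: 'n set)}"
  have Q: "finite ?Q" "?Q \<noteq> {}"
    using permutes_id[of "UNIV :: 'n set"] by (auto simp: finite_permutations simp del: permutes_id)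
  define p where "p = arg_min_on F ?Q"
  have p: "p permutes UNIV" using arg_min_if_finite(1)[OF Q, of F] by (simp add: p_def)
  have least: "F p \<le> F q" if "q permutes UNIV" for q
    unfolding p_def using arg_min_least[OF Q, of q F] that by simp
  have "(d i - d j) * (l (p i) - l (p j)) \<le> 0" for i j
  proof (cases "i = j")
    case False
    define q where "q = p \<circ> Transposition.transpose i j"
    have "q permutes UNIV"
      unfolding q_def by (intro permutes_compose[OF permutes_swap_id p]) auto
    hence "F p \<le> F q" by (rule least)
    moreover have "F r = d i * l (r i) + d j * l (r j) + (\<Sum>m\<in>UNIV - {i, j}. d m * l (r m))" for r
      unfolding F_def using False
      by (subst sum.subset_diff[of "{i, j}"]) auto
    moreover have "(\<Sum>m\<in>UNIV - {i, j}. d m * l (q m)) = (\<Sum>m\<in>UNIV - {i, j}. d m * l (p m))"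
      by (intro sum.cong) (auto simp: q_def Transposition.transpose_def)
    ultimately show ?thesis by (simp add: q_def algebra_simps)
  qed simp
  then obtain f where f: "\<And>i j. f i - f j \<le> l (p j) * (d i - d j)"
    using supergradient_potential[of UNIV d "\<lambda>i. l (p i)"] by auto
  have reindex: "(\<Sum>j\<in>UNIV. g (p j)) = (\<Sum>j\<in>UNIV. g j)" for g :: "'n \<Rightarrow> real"
    using sum.permute[OF p, of g] by (simp add: o_def)
  have "(\<Sum>i\<in>UNIV. d i * l (p i)) = (\<Sum>j\<in>UNIV. (\<Sum>i\<in>UNIV. P i (p j)) * (d j * l (p j) - f j)) + (\<Sum>i\<in>UNIV. (\<Sum>j\<in>UNIV. P i (p j)) * f i)"
    unfolding col reindex row by (simp add: sum_subtractf)
  also have "\<dots> = (\<Sum>i\<in>UNIV. \<Sum>j\<in>UNIV. P i (p j) * (d j * l (p j) + f i - f j))"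
    unfolding sum_distrib_right by (subst sum.swap) (simp add: sum.distrib[symmetric] algebra_simps)
  also have "\<dots> \<le> (\<Sum>i\<in>UNIV. \<Sum>j\<in>UNIV. P i (p j) * (d i * l (p j)))"
  proof (intro sum_mono mult_left_mono nonneg)
    fix i j show "d j * l (p j) + f i - f j \<le> d i * l (p j)"
      using f[of i j] by (simp add: algebra_simps)
  qed
  also have "\<dots> = (\<Sum>i\<in>UNIV. \<Sum>j\<in>UNIV. P i j * d i * l j)"
    by (subst reindex) (simp add: mult_ac)
  finally show ?thesis using p by blast
qed

text \<open>A maximiser \<open>v\<close> of the quadratic form on the unit sphere of
  \<open>V\<close> is an eigenvector: the residual \<open>w = f v - c v\<close> is orthogonal to
  \<open>v\<close>, and perturbing \<open>v\<close> to \<open>v + t w\<close> gives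
  \<open>2 t (w \<bullet> w) \<le> t^2 b\<close> for every \<open>t\<close>, hence
  \<open>w = 0\<close>.\<close>

lemma self_adjoint_eigenvector:
  fixes f :: "'a::euclidean_space \<Rightarrow> 'a"
  assumes lin: "linear f" and adj: "\<And>x y. f x \<bullet> y = x \<bullet> f y"
    and V: "subspace V" "f ` V \<subseteq> V" "V \<noteq> {0}"
  shows "\<exists>v c. v \<in> V \<and> norm v = 1 \<and> f v = c *\<^sub>R v"
proof -
  interpret linear f by (rule lin)
  let ?K = "V \<inter> sphere 0 1"
  have "0 \<in> V" using V(1) by (rule subspace_0)
  then obtain u where u: "u \<in> V" "u \<noteq> 0" using V(3) by blast
  have unit: "u /\<^sub>R norm u \<in> ?K" if "u \<in> V" "u \<noteq> 0" for u
    using that V(1) by (auto intro: subspace_scale)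
  have "compact ?K"
    by (intro closed_Int_compact closed_subspace[OF V(1)] compact_sphere)
  moreover have "?K \<noteq> {}" using unit[OF u] by blast
  moreover have "continuous_on ?K (\<lambda>x. x \<bullet> f x)"
    by (intro continuous_intros linear_continuous_on linear_conv_bounded_linear[THEN iffD1] lin)
  ultimately obtain v where v: "v \<in> ?K" and max: "\<And>x. x \<in> ?K \<Longrightarrow> x \<bullet> f x \<le> v \<bullet> f v"
    using continuous_attains_sup[of ?K "\<lambda>x. x \<bullet> f x"] by blast
  define c where "c = v \<bullet> f v"
  have vv: "v \<bullet> v = 1" using v by (simp add: norm_eq_1)
  have rayleigh: "x \<bullet> f x \<le> c * (x \<bullet> x)" if x: "x \<in> V" for x
  proof (cases "x = 0")
    case False
    have "(x /\<^sub>R norm x) \<bullet> f (x /\<^sub>R norm x) \<le> c"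
      unfolding c_def by (rule max[OF unit[OF x False]])
    hence "(x \<bullet> f x) / (norm x)\<^sup>2 \<le> c"
      by (simp add: scale power2_eq_square field_simps)
    thus ?thesis using False by (simp add: field_simps power2_norm_eq_inner)
  qed (simp add: zero)
  define w where "w = f v - c *\<^sub>R v"
  have wV: "w \<in> V" unfolding w_def using v V by (auto intro!: subspace_diff subspace_scale)
  have wv: "v \<bullet> w = 0" by (simp add: w_def inner_diff_right c_def vv)
  have fvw: "f v \<bullet> w = w \<bullet> w"
    using wv by (simp add: w_def inner_diff_left)
  define b where "b = c * (w \<bullet> w) - w \<bullet> f w"
  have "2 * t * (w \<bullet> w) \<le> t\<^sup>2 * b" for t
  proof -
    have "(v + t *\<^sub>R w) \<bullet> f (v + t *\<^sub>R w) \<le> c * ((v + t *\<^sub>R w) \<bullet> (v + t *\<^sub>R w))"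
      using v wV V(1) by (intro rayleigh subspace_add subspace_scale) auto
    moreover have "v \<bullet> f w = w \<bullet> w" using fvw adj by simp
    moreover have "w \<bullet> f v = w \<bullet> w" using fvw by (simp add: inner_commute)
    moreover have "w \<bullet> v = 0" using wv by (simp add: inner_commute)
    ultimately show ?thesis
      by (simp add: add scale inner_add_left inner_add_right wv vv b_def c_def[symmetric] power2_eq_square algebra_simps)
  qed
  note quad = this
  have "w \<bullet> w \<le> 0"
  proof (rule ccontr)
    assume "\<not> w \<bullet> w \<le> 0"
    hence pos: "0 < w \<bullet> w" by (simp only: not_le)
    \<comment> \<open>Small enough that \<open>t * b\<close> is at most
      \<open>w \<bullet> w\<close>, while \<open>quad\<close> demands at least twice that.\<close>
    define t where "t = (w \<bullet> w) / (\<bar>b\<bar> + 1)"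
    have t: "0 < t" using pos by (simp add: t_def)
    have "2 * (w \<bullet> w) \<le> t * b"
      using quad[of t] t by (simp add: power2_eq_square mult.assoc)
    also have "\<dots> \<le> t * (\<bar>b\<bar> + 1)" using t by (intro mult_left_mono) auto
    also have "\<dots> = w \<bullet> w" by (simp add: t_def)
    finally show False using pos by simp
  qed
  hence "w = 0" by (metis inner_gt_zero_iff not_le)
  thus ?thesis using v by (intro exI[of _ v] exI[of _ c]) (auto simp: w_def)
qed

text \<open>Induction over invariant subspaces: by self-adjointness, the orthogonal complement of an
  eigenvector within \<open>V\<close> is again invariant, and its dimension is smaller.\<close>

lemma self_adjoint_orthonormal_eigenbasis:
  fixes f :: "'a::euclidean_space \<Rightarrow> 'a"
  assumes lin: "linear f" and adj: "\<And>x y. f x \<bullet> y = x \<bullet> f y"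
  shows "subspace V \<Longrightarrow> f ` V \<subseteq> V \<Longrightarrow>
    \<exists>B. pairwise orthogonal B \<and> (\<forall>b\<in>B. norm b = 1 \<and> (\<exists>c. f b = c *\<^sub>R b)) \<and> span B = V"
proof (induction "dim V" arbitrary: V rule: less_induct)
  case less
  show ?case
  proof (cases "V = {0}")
    case False
    obtain v c where v: "v \<in> V" "norm v = 1" "f v = c *\<^sub>R v"
      using self_adjoint_eigenvector[OF lin adj less.prems False] by blast
    have vv: "v \<bullet> v = 1" using v by (simp add: norm_eq_1)
    define W where "W = V \<inter> {y. orthogonal v y}"
    have W: "subspace W"
      unfolding W_def by (rule subspace_inter[OF less.prems(1) subspace_orthogonal_to_vector])
    have "v \<bullet> f y = 0" if "v \<bullet> y = 0" for y
      using adj[of v y] v(3) that by simp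
    hence fW: "f ` W \<subseteq> W" using less.prems(2) by (auto simp: W_def orthogonal_def)
    have "v \<notin> W" using vv by (simp add: W_def orthogonal_def)
    hence "W \<subset> V" using v(1) by (auto simp: W_def)
    hence "dim W < dim V"
      using W less.prems(1) by (intro dim_psubset) (simp add: span_eq_iff[THEN iffD2])
    then obtain B where B: "pairwise orthogonal B" "\<forall>b\<in>B. norm b = 1 \<and> (\<exists>c. f b = c *\<^sub>R b)" "span B = W"
      using less.hyps[OF _ W fW] by blast
    have BW: "B \<subseteq> W" using B(3) span_superset by blast
    have "pairwise orthogonal (insert v B)"
      using B(1) BW by (auto simp: pairwise_insert W_def orthogonal_commute)
    moreover have "span (insert v B) = V"
    proof
      show "span (insert v B) \<subseteq> V"
        using v BW less.prems(1) by (intro span_minimal) (auto simp: W_def)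
      show "V \<subseteq> span (insert v B)"
      proof
        fix x assume x: "x \<in> V"
        have "x - (x \<bullet> v) *\<^sub>R v \<in> W"
          using x v vv less.prems(1)
          by (auto simp: W_def orthogonal_def inner_diff_right inner_commute intro!: subspace_diff subspace_scale)
        thus "x \<in> span (insert v B)" unfolding B(3)[symmetric] span_insert by blast
      qed
    qed
    ultimately show ?thesis using B(2) v by (intro exI[of _ "insert v B"]) auto
  qed (auto intro: exI[of _ "{}"])
qed

section \<open>Eigenvalue vectors and traces of orthogonally diagonalised matrices\<close>

definition diag_mat :: "real ^ 'n \<Rightarrow> real ^ 'n ^ 'n" where
  "diag_mat l = (\<chi> i j. if i = j then l $ i else 0)"

lemma conj_diag_mat_nth:
  "(U ** diag_mat l ** transpose U) $ a $ b = (\<Sum>c\<in>UNIV. U $ a $ c * l $ c * U $ b $ c)"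
  by (simp add: matrix_matrix_mult_def diag_mat_def transpose_def if_distrib cong: if_cong)

lemma transpose_conj_diag_mat: "transpose (U ** diag_mat l ** transpose U) = U ** diag_mat l ** transpose U"
proof -
  have "transpose A = A" if "\<And>a b. A $ a $ b = A $ b $ a" for A :: "real ^ 'a ^ 'a"
    using that by (simp add: transpose_def vec_eq_iff)
  note sym = this
  show ?thesis by (rule sym) (simp add: conj_diag_mat_nth mult_ac)
qed

lemma symmetric_matrix_diagonalization:
  fixes M :: "real ^ 'n ^ 'n"
  assumes M: "transpose M = M"
  obtains U l where "orthogonal_matrix U" "M = U ** diag_mat l ** transpose U"
proof -
  have "(M *v x) \<bullet> y = x \<bullet> (M *v y)" for x y :: "real ^ 'n"
    using dot_lmul_matrix[of x M y] transpose_matrix_vector[of M x] M by simp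
  from self_adjoint_orthonormal_eigenbasis[OF matrix_vector_mul_linear this, of UNIV]
  obtain B where B: "pairwise orthogonal B" "\<forall>b\<in>B. norm b = 1 \<and> (\<exists>c. M *v b = c *\<^sub>R b)" "span B = (UNIV :: (real ^ 'n) set)"
    by auto
  have "0 \<notin> B" using B(2) by force
  hence ind: "independent B" by (rule pairwise_orthogonal_independent[OF B(1)])
  have "card B = CARD('n)"
    using dim_eq_card_independent[OF ind] dim_span[of B] B(3) by simp
  then obtain h :: "'n \<Rightarrow> real ^ 'n" where h: "bij_betw h UNIV B"
    using finite_same_card_bij[of "UNIV :: 'n set" B] independent_imp_finite[OF ind] by auto
  hence hB: "h i \<in> B" and inj: "inj h" for i unfolding bij_betw_def by blast+
  have "\<exists>c. M *v h i = c *\<^sub>R h i" for i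
    using B(2) hB[of i] by blast
  then obtain c where c: "\<And>i. M *v h i = c i *\<^sub>R h i"
    by metis
  define U :: "real ^ 'n ^ 'n" where "U = (\<chi> a i. h i $ a)"
  have col: "column i U = h i" for i by (simp add: column_def U_def vec_eq_iff)
  have "orthogonal (h i) (h j)" if "i \<noteq> j" for i j
    by (rule pairwiseD[OF B(1) hB hB]) (use that inj in \<open>simp add: inj_eq\<close>)
  hence U: "orthogonal_matrix U"
    unfolding orthogonal_matrix_orthonormal_columns col using bspec[OF B(2) hB] by simp
  have "(M ** U) $ a $ i = (U ** diag_mat (\<chi> i. c i)) $ a $ i" for a i
  proof -
    have "(M ** U) $ a $ i = (M *v h i) $ a"
      by (simp add: matrix_matrix_mult_def matrix_vector_mult_def U_def)
    also have "\<dots> = (U ** diag_mat (\<chi> i. c i)) $ a $ i"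
      unfolding c by (simp add: matrix_matrix_mult_def U_def diag_mat_def if_distrib cong: if_cong)
    finally show ?thesis .
  qed
  hence "M ** U = U ** diag_mat (\<chi> i. c i)" by (simp add: vec_eq_iff)
  hence "M ** (U ** transpose U) = U ** diag_mat (\<chi> i. c i) ** transpose U"
    by (simp add: matrix_mul_assoc)
  thus ?thesis using that U by (simp add: orthogonal_matrix_def)
qed

lemma det_mat_minus_conj_diag_mat:
  fixes U :: "real ^ 'n ^ 'n"
  assumes U: "orthogonal_matrix U"
  shows "det (mat x - U ** diag_mat l ** transpose U) = (\<Prod>i\<in>UNIV. x - l $ i)"
proof -
  have UU: "U ** transpose U = mat 1" using U by (simp add: orthogonal_matrix_def)
  have "mat x - U ** diag_mat l ** transpose U = U ** diag_mat (\<chi> i. x - l $ i) ** transpose U"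
  proof (intro vec_eq_iff[THEN iffD2] allI)
    fix a b
    have "(\<Sum>c\<in>UNIV. U $ a $ c * U $ b $ c) = (if a = b then 1 else 0)"
      using arg_cong[OF UU, of "\<lambda>A. A $ a $ b"] by (simp add: matrix_matrix_mult_def transpose_def mat_def)
    hence "x * (\<Sum>c\<in>UNIV. U $ a $ c * U $ b $ c) = (mat x :: real ^ 'n ^ 'n) $ a $ b"
      by (simp add: mat_def)
    thus "(mat x - U ** diag_mat l ** transpose U) $ a $ b = (U ** diag_mat (\<chi> i. x - l $ i) ** transpose U) $ a $ b"
      unfolding vector_minus_component conj_diag_mat_nth
      by (simp add: algebra_simps sum_subtractf sum_distrib_left)
  qed
  hence "det (mat x - U ** diag_mat l ** transpose U) = det (U ** transpose U) * det (diag_mat (\<chi> i. x - l $ i))"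
    by (simp add: det_mul)
  also have "\<dots> = (\<Prod>i\<in>UNIV. x - l $ i)"
    unfolding UU by (subst det_diagonal) (simp_all add: diag_mat_def)
  finally show ?thesis .
qed

text \<open>Equal products of linear factors have equal multisets of roots, and equal multisets
  differ by a permutation of the index type. This controls the arbitrary order chosen by
  \<open>SOME\<close> in \<open>eigvals\<close>.\<close>

lemma linear_factors_permutation:
  fixes e l :: "'n::finite \<Rightarrow> real"
  assumes "\<And>x. (\<Prod>i\<in>UNIV. x - e i) = (\<Prod>i\<in>UNIV. x - l i)"
  obtains p where "p permutes UNIV" "\<And>i. e i = l (p i)"
proof -
  have roots: "proots (\<Prod>i\<in>UNIV. [:- f i, 1:]) = image_mset f (mset_set UNIV)" for f :: "'n \<Rightarrow> real"
  proof -
    have "(\<Sum>i\<in>A. {#f i#}) = image_mset f (mset_set A)" if "finite A" for A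
      using that by induction auto
    thus ?thesis by (simp add: proots_prod)
  qed
  have "poly (\<Prod>i\<in>UNIV. [:- e i, 1:]) = poly (\<Prod>i\<in>UNIV. [:- l i, 1:])"
    using assms by (intro ext) (simp add: poly_prod)
  hence "(\<Prod>i\<in>UNIV. [:- e i, 1:]) = (\<Prod>i\<in>UNIV. [:- l i, 1:])"
    by (simp only: poly_eq_poly_eq_iff)
  hence "image_mset e (mset_set UNIV) = image_mset l (mset_set UNIV)"
    using roots by metis
  thus ?thesis using that image_mset_eq_implies_permutes[of UNIV e l] by auto
qed

lemma eigvals_conj_diag_mat:
  fixes U :: "real ^ 'n ^ 'n"
  assumes U: "orthogonal_matrix U"
  obtains p where "p permutes UNIV" "\<And>i. eigvals (U ** diag_mat l ** transpose U) $ i = l $ p i"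
proof -
  let ?M = "U ** diag_mat l ** transpose U"
  have "\<forall>x. det (mat x - ?M) = (\<Prod>i\<in>UNIV. x - eigvals ?M $ i)"
    unfolding eigvals_def by (rule someI[of _ l]) (simp add: det_mat_minus_conj_diag_mat[OF U])
  hence "(\<Prod>i\<in>UNIV. x - eigvals ?M $ i) = (\<Prod>i\<in>UNIV. x - l $ i)" for x
    by (simp add: det_mat_minus_conj_diag_mat[OF U])
  from linear_factors_permutation[OF this] that show ?thesis by blast
qed

lemma symmetric_matrix_eigvals_diagonalization:
  fixes M :: "real ^ 'n ^ 'n"
  assumes M: "transpose M = M"
  obtains U where "orthogonal_matrix U" "M = U ** diag_mat (eigvals M) ** transpose U"
proof -
  obtain U l where U: "orthogonal_matrix U" "M = U ** diag_mat l ** transpose U"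
    using symmetric_matrix_diagonalization[OF M] .
  obtain p where p: "p permutes UNIV" "\<And>i. eigvals M $ i = l $ p i"
    using eigvals_conj_diag_mat[OF U(1), of l] U(2) by metis
  \<comment> \<open>Permuting the columns of \<open>U\<close> lists the eigenvectors in the order
    chosen by \<open>eigvals\<close>.\<close>
  define V :: "real ^ 'n ^ 'n" where "V = (\<chi> a i. U $ a $ p i)"
  have "column i V = column (p i) U" for i by (simp add: column_def V_def)
  moreover have "p i \<noteq> p j" if "i \<noteq> j" for i j
    using that permutes_inj[OF p(1)] by (auto simp: inj_def)
  ultimately have V: "orthogonal_matrix V"
    using U(1) by (simp add: orthogonal_matrix_orthonormal_columns)
  have "M $ a $ b = (V ** diag_mat (eigvals M) ** transpose V) $ a $ b" for a b
  proof -
    have "M $ a $ b = (\<Sum>c\<in>UNIV. U $ a $ c * l $ c * U $ b $ c)"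
      by (simp add: U(2) conj_diag_mat_nth)
    also have "\<dots> = (\<Sum>c\<in>UNIV. U $ a $ p c * l $ p c * U $ b $ p c)"
      by (subst sum.permute[OF p(1)]) (simp add: o_def)
    finally show ?thesis by (simp add: conj_diag_mat_nth V_def p(2))
  qed
  hence "M = V ** diag_mat (eigvals M) ** transpose V" by (simp add: vec_eq_iff)
  thus ?thesis using that V by blast
qed

text \<open>By cyclicity of the trace only the relative rotation \<open>transpose V ** U\<close>
  enters; for orthogonal \<open>U\<close> and \<open>V\<close> its squared entries form a doubly
  stochastic matrix.\<close>

lemma trace_mul_conj_diag_mat:
  fixes U V :: "real ^ 'n ^ 'n"
  shows "trace ((U ** diag_mat l ** transpose U) ** (V ** diag_mat s ** transpose V)) =
    (\<Sum>i\<in>UNIV. \<Sum>j\<in>UNIV. ((transpose V ** U) $ i $ j)\<^sup>2 * s $ i * l $ j)"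
proof -
  let ?W = "transpose V ** U"
  have "trace ((U ** diag_mat l ** transpose U) ** (V ** diag_mat s ** transpose V)) =
      trace (transpose V ** ((U ** diag_mat l ** transpose U) ** (V ** diag_mat s)))"
    by (subst trace_mul_sym) (simp add: matrix_mul_assoc)
  also have "transpose V ** ((U ** diag_mat l ** transpose U) ** (V ** diag_mat s)) =
      (?W ** diag_mat l ** transpose ?W) ** diag_mat s"
    by (simp add: matrix_mul_assoc matrix_transpose_mul transpose_transpose)
  also have "trace \<dots> = (\<Sum>i\<in>UNIV. (?W ** diag_mat l ** transpose ?W) $ i $ i * s $ i)"
    unfolding trace_def
    by (subst matrix_matrix_mult_def) (simp add: diag_mat_def mult_delta_right)
  finally show ?thesis
    unfolding conj_diag_mat_nth by (simp add: sum_distrib_left power2_eq_square mult_ac)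
qed

lemma conj_diag_mat_square:
  fixes U :: "real ^ 'n ^ 'n"
  assumes U: "orthogonal_matrix U"
  shows "(U ** diag_mat a ** transpose U) ** (U ** diag_mat a ** transpose U) =
    U ** diag_mat (\<chi> i. (a $ i)\<^sup>2) ** transpose U"
proof -
  have "(U ** diag_mat a ** transpose U) ** (U ** diag_mat a ** transpose U) =
      U ** diag_mat a ** (transpose U ** U) ** diag_mat a ** transpose U"
    by (simp only: matrix_mul_assoc)
  also have "\<dots> = U ** (diag_mat a ** diag_mat a) ** transpose U"
    using U by (simp add: orthogonal_matrix_def matrix_mul_assoc)
  also have "diag_mat a ** diag_mat a = diag_mat (\<chi> i. (a $ i)\<^sup>2)"
    by (simp add: vec_eq_iff matrix_matrix_mult_def diag_mat_def mult_delta_left power2_eq_square)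
  finally show ?thesis .
qed

lemma conj_diag_mat_psd:
  fixes U :: "real ^ 'n ^ 'n"
  assumes "\<And>i. 0 \<le> a $ i"
  shows "U ** diag_mat a ** transpose U \<in> psd_matrices"
proof -
  have diag: "y \<bullet> (diag_mat a *v y) = (\<Sum>i\<in>UNIV. a $ i * (y $ i)\<^sup>2)" for y
    by (simp add: inner_vec_def matrix_vector_mult_def diag_mat_def mult_delta_left mult_delta_right power2_eq_square mult_ac)
  have "0 \<le> x \<bullet> ((U ** diag_mat a ** transpose U) *v x)" for x
  proof -
    have "x \<bullet> ((U ** diag_mat a ** transpose U) *v x) = (transpose U *v x) \<bullet> (diag_mat a *v (transpose U *v x))"
      by (simp add: matrix_vector_mul_assoc[symmetric] dot_lmul_matrix)
    also have "\<dots> = (\<Sum>i\<in>UNIV. a $ i * ((transpose U *v x) $ i)\<^sup>2)"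
      by (rule diag)
    also have "\<dots> \<ge> 0" using assms by (intro sum_nonneg) auto
    finally show ?thesis .
  qed
  thus ?thesis by (simp add: psd_matrices_def sym_matrices_def transpose_conj_diag_mat)
qed

lemma orthogonal_matrix_squares_doubly_stochastic:
  fixes W :: "real ^ 'n ^ 'n"
  assumes "orthogonal_matrix W"
  shows "(\<Sum>j\<in>UNIV. (W $ i $ j)\<^sup>2) = 1" "(\<Sum>i\<in>UNIV. (W $ i $ j)\<^sup>2) = 1"
proof -
  have "W ** transpose W = mat 1" "transpose W ** W = mat 1" using assms by (auto simp: orthogonal_matrix_def)
  thus "(\<Sum>j\<in>UNIV. (W $ i $ j)\<^sup>2) = 1" "(\<Sum>i\<in>UNIV. (W $ i $ j)\<^sup>2) = 1"
    by (auto simp: vec_eq_iff matrix_matrix_mult_def transpose_def mat_def power2_eq_square)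
qed

section \<open>Eigenvalue cones and the trace functional\<close>

lemma esym_reindex:
  assumes "inj_on p S"
  shows "esym (p ` S) j x = esym S j (\<lambda>i. x (p i))"
proof -
  have "(\<Sum>I | I \<subseteq> p ` S \<and> card I = j. \<Prod>i\<in>I. x i) = (\<Sum>J\<in>{J. J \<subseteq> S \<and> card J = j}. \<Prod>i\<in>p ` J. x i)"
  proof (rule sum.reindex_cong[of "(`) p"])
    show "inj_on ((`) p) {J. J \<subseteq> S \<and> card J = j}"
      using inj_on_image_Pow[OF assms] by (rule inj_on_subset) auto
    show "{I. I \<subseteq> p ` S \<and> card I = j} = (`) p ` {J. J \<subseteq> S \<and> card J = j}"
      using assms by (auto simp: subset_image_iff card_image inj_on_subset)
  qed auto
  also have "\<dots> = (\<Sum>J\<in>{J. J \<subseteq> S \<and> card J = j}. \<Prod>i\<in>J. x (p i))"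
    using assms by (intro sum.cong refl) (auto simp: prod.reindex inj_on_subset)
  finally show ?thesis by (simp add: esym_def)
qed

lemma esym_permute:
  assumes "p permutes UNIV"
  shows "esym UNIV j (\<lambda>i. x (p i)) = esym UNIV j x"
    and "esym (UNIV - {i}) j (\<lambda>m. x (p m)) = esym (UNIV - {p i}) j x"
proof -
  have inj: "inj p" and img: "p ` UNIV = UNIV" using assms by (auto simp: permutes_inj permutes_image)
  show "esym UNIV j (\<lambda>i. x (p i)) = esym UNIV j x"
    using esym_reindex[OF inj] img by simp
  have "p ` (UNIV - {i}) = UNIV - {p i}" using image_set_diff[OF inj] img by simp
  thus "esym (UNIV - {i}) j (\<lambda>m. x (p m)) = esym (UNIV - {p i}) j x"
    using esym_reindex[OF inj_on_subset[OF inj], of "UNIV - {i}"] by simp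
qed

lemma elem_sym_eq_esym: "elem_sym j l = esym UNIV j (\<lambda>i. l $ i)"
  by (simp add: elem_sym_def esym_def)

text \<open>Setting an entry to 0 kills every product through it and leaves the others unchanged, so
  it amounts to deleting the index.\<close>

lemma elem_sym_omit_eq_esym:
  fixes g :: "real ^ 'n"
  shows "elem_sym_omit j i g = esym (UNIV - {i}) j (\<lambda>i. g $ i)"
proof -
  have "(\<Prod>m\<in>I. if m = i then 0 else g $ m) = 0" if "i \<in> I" for I :: "'n set"
    using that by (intro prod_zero) auto
  thus ?thesis
    unfolding elem_sym_omit_def elem_sym_def esym_def
    by (intro sum.mono_neutral_cong_right prod.cong) auto
qed

text \<open>Order 0 may be included because its value is 1; the inductions above use the cone in
  this form.\<close>

lemma Gamma_cone_iff: "g \<in> Gamma_cone k \<longleftrightarrow> (\<forall>j\<le>k. 0 < esym UNIV j (\<lambda>i. g $ i))"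
proof -
  have "0 < esym UNIV j (\<lambda>i. g $ i)" if "\<forall>j\<in>{1..k}. 0 < esym UNIV j (\<lambda>i. g $ i)" "j \<le> k" for j
    using that by (cases "j = 0") auto
  thus ?thesis by (auto simp: Gamma_cone_def elem_sym_eq_esym)
qed

text \<open>The weak inequalities define a closed set containing the cone; conversely, every
  diagonal shift of \<open>l\<close> by \<open>c > 0\<close> lies in the cone and tends to
  \<open>l\<close>.\<close>

lemma closure_Gamma_cone:
  fixes l :: "real ^ 'n"
  assumes k: "k \<le> CARD('n)"
  shows "l \<in> closure (Gamma_cone k) \<longleftrightarrow> (\<forall>j\<le>k. 0 \<le> esym UNIV j (\<lambda>i. l $ i))"
proof
  let ?C = "\<Inter>j\<in>{..k}. {l :: real ^ 'n. 0 \<le> esym UNIV j (\<lambda>i. l $ i)}"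
  have "closed ?C"
    by (intro closed_INT ballI closed_Collect_le continuous_intros) auto
  moreover have "Gamma_cone k \<subseteq> ?C" by (auto simp: Gamma_cone_iff less_imp_le)
  ultimately have "closure (Gamma_cone k) \<subseteq> ?C" by (rule closure_minimal[rotated])
  moreover assume "l \<in> closure (Gamma_cone k)"
  ultimately show "\<forall>j\<le>k. 0 \<le> esym UNIV j (\<lambda>i. l $ i)" by blast
next
  assume l: "\<forall>j\<le>k. 0 \<le> esym UNIV j (\<lambda>i. l $ i)"
  have "\<forall>\<^sub>F c in at_right 0. (\<chi> i. l $ i + c) \<in> closure (Gamma_cone k)"
  proof (rule eventually_mono[OF eventually_at_right_less])
    fix c :: real assume "0 < c"
    hence "(\<chi> i. l $ i + c) \<in> Gamma_cone k"
      using esym_shift_pos[OF _ k l] by (simp add: Gamma_cone_iff)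
    thus "(\<chi> i. l $ i + c) \<in> closure (Gamma_cone k)" using closure_subset by blast
  qed
  moreover have "((\<lambda>c. \<chi> i. l $ i + c) \<longlongrightarrow> l) (at_right 0)"
  proof (rule vec_tendstoI)
    fix i show "((\<lambda>c. (\<chi> i. l $ i + c) $ i) \<longlongrightarrow> l $ i) (at_right 0)"
      by simp (rule tendsto_eq_intros refl | simp)+
  qed
  ultimately show "l \<in> closure (Gamma_cone k)"
    by (intro Lim_in_closed_set[OF closed_closure]) auto
qed

lemma trace_symmetric_square:
  fixes A M :: "real ^ 'n ^ 'n"
  assumes "transpose A = A"
  shows "trace (transpose A ** M ** A) = trace (M ** (A ** A))"
proof -
  have "trace (A ** M ** A) = trace (A ** (A ** M))" by (rule trace_mul_sym)
  also have "\<dots> = trace (M ** (A ** A))"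
    unfolding matrix_mul_assoc by (subst trace_mul_sym) (simp only: matrix_mul_assoc)
  finally show ?thesis using assms by simp
qed

text \<open>Give \<open>A\<close> the eigenvectors of \<open>M\<close> and, as eigenvalues, the
  square roots of the partial derivatives at \<open>g\<close>. The relative rotation is then the
  identity and the double sum collapses to its diagonal.\<close>

lemma A_set_realizes_diagonal:
  fixes M :: "real ^ 'n ^ 'n"
  assumes M: "M \<in> sym_matrices" and g: "\<forall>j\<le>Suc k. 0 < esym UNIV j g" "esym UNIV (Suc k) g = 1"
  shows "\<exists>A \<in> A_set (Suc k). trace (transpose A ** M ** A) = (\<Sum>i\<in>UNIV. eigvals M $ i * esym (UNIV - {i}) k g)"
proof -
  obtain U where U: "orthogonal_matrix U" "M = U ** diag_mat (eigvals M) ** transpose U"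
    using symmetric_matrix_eigvals_diagonalization[of M] M by (auto simp: sym_matrices_def)
  define a :: "real ^ 'n" where "a = (\<chi> i. sqrt (esym (UNIV - {i}) k g))"
  have d: "0 < esym (UNIV - {i}) k g" for i
    using esym_remove_pos[OF _ _ g(1), of i] by simp
  hence a2: "(a $ i)\<^sup>2 = esym (UNIV - {i}) k g" and a0: "0 \<le> a $ i" for i
    by (simp_all add: a_def less_imp_le)
  define A where "A = U ** diag_mat a ** transpose U"
  obtain p where p: "p permutes UNIV" "\<And>i. eigvals A $ i = a $ p i"
    unfolding A_def using eigvals_conj_diag_mat[OF U(1)] by blast
  have psd: "A \<in> psd_matrices" unfolding A_def by (rule conj_diag_mat_psd[OF a0])
  \<comment> \<open>\<open>eigvals A\<close> lists the entries of \<open>a\<close> in an order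
    \<open>p\<close>, so the point witnessing membership in \<open>A_set\<close> is \<open>g\<close>
    permuted accordingly.\<close>
  define h :: "real ^ 'n" where "h = (\<chi> i. g (p i))"
  have "h \<in> Gamma_cone (Suc k)" "elem_sym (Suc k) h = 1"
    using g by (simp_all add: Gamma_cone_iff elem_sym_eq_esym h_def esym_permute(1)[OF p(1)])
  moreover have "(eigvals A $ i)\<^sup>2 = elem_sym_omit (Suc k - 1) i h" for i
    by (simp add: elem_sym_omit_eq_esym h_def esym_permute(2)[OF p(1)] p(2) a2)
  ultimately have "A \<in> A_set (Suc k)" unfolding A_set_def using psd by blast
  moreover have "trace (transpose A ** M ** A) = (\<Sum>i\<in>UNIV. eigvals M $ i * esym (UNIV - {i}) k g)"
  proof -
    have "transpose A = A" unfolding A_def by (rule transpose_conj_diag_mat)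
    hence "trace (transpose A ** M ** A) = trace (M ** (A ** A))" by (rule trace_symmetric_square)
    also have "\<dots> = trace ((U ** diag_mat (eigvals M) ** transpose U) ** (U ** diag_mat (\<chi> i. (a $ i)\<^sup>2) ** transpose U))"
      unfolding A_def conj_diag_mat_square[OF U(1)] U(2)[symmetric] ..
    also have "\<dots> = (\<Sum>i\<in>UNIV. eigvals M $ i * esym (UNIV - {i}) k g)"
      unfolding trace_mul_conj_diag_mat using U(1)
      by (simp add: orthogonal_matrix_def mat_def a2 if_distrib if_distribR mult_ac cong: if_cong)
    finally show ?thesis .
  qed
  ultimately show ?thesis by blast
qed

lemma A_set_trace_lower_bound:
  fixes M :: "real ^ 'n ^ 'n"
  assumes M: "M \<in> sym_matrices" and k: "Suc k \<le> CARD('n)"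
    and l: "\<forall>j\<le>Suc k. 0 \<le> esym UNIV j (\<lambda>i. eigvals M $ i)" and A: "A \<in> A_set (Suc k)"
  shows "real (Suc k) * root (Suc k) (elem_sym (Suc k) (eigvals M)) \<le> trace (transpose A ** M ** A)"
proof -
  obtain g where g: "g \<in> Gamma_cone (Suc k)" "elem_sym (Suc k) g = 1"
    and eig: "\<And>i. (eigvals A $ i)\<^sup>2 = elem_sym_omit k i g"
    using A by (auto simp: A_set_def)
  have symA: "transpose A = A" using A by (simp add: A_set_def psd_matrices_def sym_matrices_def)
  obtain U where U: "orthogonal_matrix U" "M = U ** diag_mat (eigvals M) ** transpose U"
    using symmetric_matrix_eigvals_diagonalization[of M] M by (auto simp: sym_matrices_def)
  obtain V where V: "orthogonal_matrix V" "A = V ** diag_mat (eigvals A) ** transpose V"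
    using symmetric_matrix_eigvals_diagonalization[OF symA] by blast
  define W where "W = transpose V ** U"
  have W: "orthogonal_matrix W"
    unfolding W_def using U(1) V(1) by (intro orthogonal_matrix_mul) simp
  define d where "d i = esym (UNIV - {i}) k (\<lambda>i. g $ i)" for i
  have "trace (transpose A ** M ** A) = trace (M ** (A ** A))" by (rule trace_symmetric_square[OF symA])
  also have "A ** A = V ** diag_mat (\<chi> i. (eigvals A $ i)\<^sup>2) ** transpose V"
    using conj_diag_mat_square[OF V(1), of "eigvals A"] by (simp only: V(2)[symmetric])
  also have "trace (M ** (V ** diag_mat (\<chi> i. (eigvals A $ i)\<^sup>2) ** transpose V)) =
      (\<Sum>i\<in>UNIV. \<Sum>j\<in>UNIV. (W $ i $ j)\<^sup>2 * d i * eigvals M $ j)"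
    using trace_mul_conj_diag_mat[of U "eigvals M" V "\<chi> i. (eigvals A $ i)\<^sup>2"]
    unfolding U(2)[symmetric] by (simp add: W_def d_def eig elem_sym_omit_eq_esym)
  finally have tr: "trace (transpose A ** M ** A) = (\<Sum>i\<in>UNIV. \<Sum>j\<in>UNIV. (W $ i $ j)\<^sup>2 * d i * eigvals M $ j)" .
  obtain p where p: "p permutes UNIV"
    and le: "(\<Sum>i\<in>UNIV. d i * eigvals M $ p i) \<le> (\<Sum>i\<in>UNIV. \<Sum>j\<in>UNIV. (W $ i $ j)\<^sup>2 * d i * eigvals M $ j)"
    using doubly_stochastic_rearrangement[of "\<lambda>i j. (W $ i $ j)\<^sup>2" d "\<lambda>j. eigvals M $ j"]
      orthogonal_matrix_squares_doubly_stochastic[OF W] by auto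
  \<comment> \<open>Garding's inequality at the permuted eigenvalues of \<open>M\<close>: symmetry
    of \<open>esym\<close> absorbs the permutation, and the factor coming from \<open>g\<close> is 1
    by normalisation.\<close>
  have "real (Suc k) * root (Suc k) (esym UNIV (Suc k) (\<lambda>i. eigvals M $ p i)) *
      root (Suc k) (esym UNIV (Suc k) (\<lambda>i. g $ i)) ^ k \<le> (\<Sum>i\<in>UNIV. eigvals M $ p i * d i)"
    unfolding d_def
    by (rule garding_inequality)
       (use g k l in \<open>auto simp: Gamma_cone_iff less_imp_le esym_permute(1)[OF p, of _ "\<lambda>i. eigvals M $ i"]\<close>)
  also have "esym UNIV (Suc k) (\<lambda>i. eigvals M $ p i) = elem_sym (Suc k) (eigvals M)"
    using esym_permute(1)[OF p, of _ "\<lambda>i. eigvals M $ i"] by (simp add: elem_sym_eq_esym)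
  also have "esym UNIV (Suc k) (\<lambda>i. g $ i) = 1" using g(2) by (simp add: elem_sym_eq_esym)
  finally show ?thesis using le tr by (simp add: mult.commute)
qed

theorem lemma1p4:
  fixes M :: "real ^ 'n ^ 'n" and k :: nat
  assumes "2 \<le> k" and "k \<le> CARD('n)"
    and "M \<in> sym_matrices"
  shows "(INF A \<in> (A_set k :: (real ^ 'n ^ 'n) set). ereal (trace (transpose A ** M ** A))) =
    (if eigvals M \<in> closure (Gamma_cone k)
     then ereal (real k * root k (elem_sym k (eigvals M)))
     else - \<infinity>)"
proof -
  \<comment> \<open>\<open>k'\<close> is the order \<open>k - 1\<close> of the partial derivatives;
    \<open>1 \<le> k'\<close> is what the unbounded case requires.\<close>
  obtain k' where k': "k = Suc k'" "1 \<le> k'" using assms(1) by (cases k) auto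
  have card: "Suc k' \<le> card (UNIV :: 'n set)" using assms(2) k' by simp
  note closure = closure_Gamma_cone[OF assms(2), of "eigvals M"]
  let ?t = "\<lambda>A. trace (transpose A ** M ** A)"
  show ?thesis
  proof (cases "eigvals M \<in> closure (Gamma_cone k)")
    case True
    hence l: "\<forall>j\<le>Suc k'. 0 \<le> esym UNIV j (\<lambda>i. eigvals M $ i)" using closure k' by simp
    let ?v = "real k * root k (elem_sym k (eigvals M))"
    have "(INF A \<in> A_set k. ereal (?t A)) = ereal ?v"
    proof (rule antisym)
      show "(INF A \<in> A_set k. ereal (?t A)) \<le> ereal ?v"
      proof (rule ereal_le_epsilon2)
        fix e :: real assume e: "0 < e"
        obtain g where g: "\<forall>j\<le>Suc k'. 0 < esym UNIV j g" "esym UNIV (Suc k') g = 1"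
          "(\<Sum>i\<in>UNIV. eigvals M $ i * esym (UNIV - {i}) k' g) < ?v + e"
          using garding_bound_approx[OF finite card l e] by (auto simp: k' elem_sym_eq_esym)
        obtain A where A: "A \<in> A_set k" "?t A < ?v + e"
          using A_set_realizes_diagonal[OF assms(3) g(1,2)] g(3) k' by auto
        have "(INF A \<in> A_set k. ereal (?t A)) \<le> ereal (?t A)" by (rule INF_lower[OF A(1)])
        also have "\<dots> \<le> ereal ?v + ereal e" using A(2) by simp
        finally show "(INF A \<in> A_set k. ereal (?t A)) \<le> ereal ?v + ereal e" .
      qed
      show "ereal ?v \<le> (INF A \<in> A_set k. ereal (?t A))"
        using A_set_trace_lower_bound[OF assms(3) _ l] card by (auto intro!: INF_greatest simp: k'(1) simp del: of_nat_Suc)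
    qed
    thus ?thesis using True by simp
  next
    case False
    hence l: "\<not> (\<forall>j\<le>Suc k'. 0 \<le> esym UNIV j (\<lambda>i. eigvals M $ i))" using closure k' by simp
    have "(INF A \<in> A_set k. ereal (?t A)) = - \<infinity>"
    proof (rule ereal_bot)
      fix B :: real
      obtain g where g: "\<forall>j\<le>Suc k'. 0 < esym UNIV j g" "esym UNIV (Suc k') g = 1"
        "(\<Sum>i\<in>UNIV. eigvals M $ i * esym (UNIV - {i}) k' g) < B"
        using garding_functional_unbounded[OF finite card k'(2) l] by blast
      obtain A where A: "A \<in> A_set k" "?t A < B"
        using A_set_realizes_diagonal[OF assms(3) g(1,2)] g(3) k' by auto
      have "(INF A \<in> A_set k. ereal (?t A)) \<le> ereal (?t A)" by (rule INF_lower[OF A(1)])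
      also have "\<dots> \<le> ereal B" using A(2) by simp
      finally show "(INF A \<in> A_set k. ereal (?t A)) \<le> ereal B" .
    qed
    thus ?thesis using False by simp
  qed
qed

end
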